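(* There is a function $f(n)=o(n^2)$ and a function $g(n)=o(n^4)$ such that for every $n$ and every graph $G$ with $n$ vertices, $$\operatorname{scp}(G)+\operatorname{scp}(\overline{G})\leq \frac{1203}{1568}n^2+f(n)$$ and $$\operatorname{scp}(G)\cdot\operatorname{scp}(\overline{G})\leq \frac{1447209}{9834496}n^4+g(n).$$ (Note $\frac{1203}{1568}<0.76722$ and $\frac{1447209}{9834496}<0.1471564$.)
   Context: All graphs are finite, simple and undirected; $\overline{G}$ is the complement of $G$. A clique partition of the edges of $G$ is a family of cliques (sets of pairwise adjacent vertices) of $G$ such that every edge of $G$ lies in exactly one member of the family. The sigma clique partition number $\operatorname{scp}(G)$ is the smallest integer $k$ for which there exists a clique partition of $E(G)$ in which the sum of the sizes (numbers of vertices) of its cliques is at most $k$. *)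

theory Defs
  imports Complex_Main "HOL-Library.Landau_Symbols" "HOL-Library.Ramsey"
begin

definition fin_simple_graph :: "'a set \<Rightarrow> 'a set set \<Rightarrow> bool"
  where "fin_simple_graph V E \<longleftrightarrow> finite V \<and> E \<subseteq> [V]\<^bsup>2\<^esup>"

definition complement_edges :: "'a set \<Rightarrow> 'a set set \<Rightarrow> 'a set set"
  where "complement_edges V E = [V]\<^bsup>2\<^esup> - E"

(* Cliques of size 0 or 1 are allowed: they cover no edge and can only increase the
   sum of the sizes.  A clique with at least two vertices cannot occur twice in a
   clique partition, so taking a set rather than an indexed family does not affect
   the minimal sum. *)
definition clique_partition :: "'a set \<Rightarrow> 'a set set \<Rightarrow> 'a set set \<Rightarrow> bool"
  where "clique_partition V E P \<longleftrightarrow>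
    (\<forall>C\<in>P. C \<subseteq> V \<and> clique C E) \<and> (\<forall>e\<in>E. \<exists>!C. C \<in> P \<and> e \<subseteq> C)"

definition scp :: "'a set \<Rightarrow> 'a set set \<Rightarrow> nat"
  where "scp V E = (LEAST k. \<exists>P. clique_partition V E P \<and> (\<Sum>C\<in>P. card C) \<le> k)"

lemma clique_partition_edges:
  assumes "fin_simple_graph V E"
  shows "clique_partition V E E"
  unfolding clique_partition_def
proof (intro conjI ballI)
  fix e assume e: "e \<in> E"
  then have *: "e \<subseteq> V" "card e = 2"
    using assms by (auto simp: fin_simple_graph_def nsets_def)
  then show "e \<subseteq> V" by simp
  show "clique e E"
    using * e by (auto simp: clique_def card_2_iff insert_commute)
  show "\<exists>!C. C \<in> E \<and> e \<subseteq> C"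
  proof (rule ex1I[of _ e])
    fix C assume C: "C \<in> E \<and> e \<subseteq> C"
    then have "finite C" "card C = 2"
      using assms by (auto simp: fin_simple_graph_def nsets_def)
    then show "C = e" using C * by (metis card_subset_eq)
  qed (use e in auto)
qed

lemma scp_attained:
  assumes "fin_simple_graph V E"
  obtains P where "finite P" "clique_partition V E P" "(\<Sum>C\<in>P. card C) = scp V E"
proof -
  let ?Q = "\<lambda>k. \<exists>P. clique_partition V E P \<and> (\<Sum>C\<in>P. card C) \<le> k"
  have "?Q (\<Sum>C\<in>E. card C)"
    using clique_partition_edges[OF assms] by blast
  then have "?Q (scp V E)"
    unfolding scp_def by (rule LeastI)
  then obtain P where P: "clique_partition V E P" "(\<Sum>C\<in>P. card C) \<le> scp V E"
    by blast
  moreover have "scp V E \<le> (\<Sum>C\<in>P. card C)"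
    unfolding scp_def by (rule Least_le) (use P in blast)
  moreover have "finite P"
    using P(1) assms
    by (auto simp: clique_partition_def fin_simple_graph_def
        intro: finite_subset[where B = "Pow V"])
  ultimately show thesis using that by simp
qed

end

theory Submission
  imports Defs "HOL-Library.Multiset" "HOL-Combinatorics.Permutations" "HOL-Real_Asymp.Real_Asymp"
begin

text \<open>Covering all edges by themselves costs \<open>n (n - 1)\<close> for a graph and its complement together, and a
  monochromatic clique on \<open>k\<close> vertices saves \<open>k (k - 2)\<close>. So one has to pack edge-disjoint
  monochromatic cliques with total savings at least \<open>365/1568 n\<^sup>2 - O(n)\<close>.

  A transversal design splits the complete graph on \<open>6 p\<close> vertices into \<open>p\<^sup>2\<close> copies of \<open>K\<^sub>6\<close> and six
  copies of \<open>K\<^sub>p\<close>. Placing it at random makes each \<open>K\<^sub>6\<close> a uniformly random six-set, and the \<open>K\<^sub>p\<close> are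
  treated by induction. It therefore suffices that the expected savings inside a random six-set are
  at least \<open>7 - O(1/n)\<close>, since \<open>7 / 30 > 365 / 1568\<close>. This is a flag algebra estimate: in each
  two-coloured \<open>K\<^sub>6\<close> the savings \<open>s\<close> satisfy \<open>467 s \<ge> 467 * 7 + T\<close> with an explicit form \<open>T\<close> whose
  sum over all six-sets is a sum of squares up to \<open>O(n\<^sup>5)\<close>. The product bound follows from the bound
  for the sum by the inequality of the means.\<close>

section \<open>Packings of monochromatic cliques\<close>

text \<open>A colouring \<open>r\<close> treats a graph and its complement at once: since
  \<open>c\<close> may be either colour, one packing can hold cliques of both graphs.\<close>

definition homogeneous :: "('a \<Rightarrow> 'a \<Rightarrow> bool) \<Rightarrow> 'a set \<Rightarrow> bool"
  where "homogeneous r K \<longleftrightarrow> (\<exists>c. \<forall>x\<in>K. \<forall>y\<in>K. x \<noteq> y \<longrightarrow> r x y = c)"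

definition packing :: "('a \<Rightarrow> 'a \<Rightarrow> bool) \<Rightarrow> 'a set \<Rightarrow> 'a set set \<Rightarrow> bool"
  where "packing r V P \<longleftrightarrow>
    (\<forall>K\<in>P. K \<subseteq> V \<and> 2 \<le> card K \<and> homogeneous r K) \<and>
    (\<forall>K\<in>P. \<forall>L\<in>P. K \<noteq> L \<longrightarrow> card (K \<inter> L) \<le> 1)"

definition savings :: "'a set set \<Rightarrow> nat"
  where "savings P = (\<Sum>K\<in>P. card K * (card K - 2))"

definition max_savings :: "('a \<Rightarrow> 'a \<Rightarrow> bool) \<Rightarrow> 'a set \<Rightarrow> nat"
  where "max_savings r V = Max (savings ` {P. packing r V P})"

lemma packing_subset_Pow: "packing r V P \<Longrightarrow> P \<subseteq> Pow V"
  by (auto simp: packing_def)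

lemma
  assumes "packing r V P" "K \<in> P"
  shows packing_subset: "K \<subseteq> V" and packing_card: "2 \<le> card K"
    and packing_homogeneous: "homogeneous r K"
  using assms unfolding packing_def by blast+

lemma packing_meet:
  "packing r V P \<Longrightarrow> K \<in> P \<Longrightarrow> L \<in> P \<Longrightarrow> K \<noteq> L \<Longrightarrow> card (K \<inter> L) \<le> 1"
  unfolding packing_def by blast

lemma finite_packings: "finite V \<Longrightarrow> finite {P. packing r V P}"
  by (rule finite_subset[of _ "Pow (Pow V)"]) (auto dest: packing_subset_Pow)

lemma finite_packing: "finite V \<Longrightarrow> packing r V P \<Longrightarrow> finite P"
  by (meson finite_Pow_iff finite_subset packing_subset_Pow)

lemma packing_empty: "packing r V {}"
  by (simp add: packing_def)

lemma savings_le_max: "finite V \<Longrightarrow> packing r V P \<Longrightarrow> savings P \<le> max_savings r V"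
  unfolding max_savings_def by (intro Max_ge) (auto simp: finite_packings)

lemma max_savings_attained:
  assumes "finite V" shows "\<exists>P. packing r V P \<and> savings P = max_savings r V"
proof -
  have "max_savings r V \<in> savings ` {P. packing r V P}"
    unfolding max_savings_def using assms packing_empty
    by (intro Max_in) (auto simp: finite_packings)
  then show ?thesis by auto
qed

text \<open>Blocks with at most one common point share no pair, so the union of optimal packings of
  the blocks is a packing of \<open>V\<close>, and no clique is counted twice.\<close>

lemma max_savings_superadditive:
  assumes V: "finite V" and I: "finite I" and sub: "\<And>i. i \<in> I \<Longrightarrow> B i \<subseteq> V"
    and meet: "\<And>i j. i \<in> I \<Longrightarrow> j \<in> I \<Longrightarrow> i \<noteq> j \<Longrightarrow> card (B i \<inter> B j) \<le> 1"
  shows "(\<Sum>i\<in>I. max_savings r (B i)) \<le> max_savings r V"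
proof -
  have fin: "finite (B i)" if "i \<in> I" for i
    using finite_subset[OF sub[OF that] V] .
  have "\<forall>i\<in>I. \<exists>P. packing r (B i) P \<and> savings P = max_savings r (B i)"
    using max_savings_attained fin by blast
  then have "\<exists>P. \<forall>i\<in>I. packing r (B i) (P i) \<and> savings (P i) = max_savings r (B i)"
    by (rule bchoice)
  then obtain P where "\<forall>i\<in>I. packing r (B i) (P i) \<and> savings (P i) = max_savings r (B i)"
    by blast
  then have P: "packing r (B i) (P i)" "savings (P i) = max_savings r (B i)" if "i \<in> I" for i
    using that by blast+
  have cross: "card (K \<inter> L) \<le> 1" if "i \<in> I" "j \<in> I" "i \<noteq> j" "K \<in> P i" "L \<in> P j" for i j K L
  proof -
    have "K \<inter> L \<subseteq> B i \<inter> B j"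
      using packing_subset[OF P(1)] that by blast
    then show ?thesis
      using meet[OF that(1-3)] card_mono[of "B i \<inter> B j" "K \<inter> L"] fin[OF that(1)] by simp
  qed
  have "packing r V (\<Union>i\<in>I. P i)"
    unfolding packing_def
  proof (intro conjI ballI impI)
    fix K assume "K \<in> (\<Union>i\<in>I. P i)"
    then obtain i where i: "i \<in> I" "K \<in> P i" by blast
    then show "K \<subseteq> V" "2 \<le> card K" "homogeneous r K"
      using packing_subset[OF P(1)[OF i(1)] i(2)] sub[OF i(1)] packing_card[OF P(1)[OF i(1)] i(2)]
        packing_homogeneous[OF P(1)[OF i(1)] i(2)] by simp_all
  next
    fix K L assume K: "K \<in> (\<Union>i\<in>I. P i)" and L: "L \<in> (\<Union>i\<in>I. P i)" and ne: "K \<noteq> L"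
    then obtain i j where ij: "i \<in> I" "j \<in> I" "K \<in> P i" "L \<in> P j" by blast
    show "card (K \<inter> L) \<le> 1"
    proof (cases "i = j")
      case True
      then show ?thesis using packing_meet[OF P(1)] ij ne by blast
    qed (use cross ij in blast)
  qed
  moreover have "savings (\<Union>i\<in>I. P i) = (\<Sum>i\<in>I. savings (P i))"
    unfolding savings_def
  proof (rule sum.UNION_disjoint[OF I])
    show "\<forall>i\<in>I. finite (P i)"
      using P(1) fin finite_packing by blast
    show "\<forall>i\<in>I. \<forall>j\<in>I. i \<noteq> j \<longrightarrow> P i \<inter> P j = {}"
    proof (intro ballI impI equals0I)
      fix i j K assume *: "i \<in> I" "j \<in> I" "i \<noteq> j" "K \<in> P i \<inter> P j"
      then have "card (K \<inter> K) \<le> 1" using cross by blast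
      moreover have "2 \<le> card K" using packing_card[OF P(1)] * by blast
      ultimately show False by simp
    qed
  qed
  moreover have "\<dots> = (\<Sum>i\<in>I. max_savings r (B i))"
    using P(2) by simp
  ultimately show ?thesis
    using savings_le_max[OF V, of r "\<Union>i\<in>I. P i"] by simp
qed

text \<open>Packings can be carried along an injection. This transports savings found on six
  abstract points to six vertices of the graph.\<close>

lemma max_savings_image:
  assumes "inj_on h U" "finite U"
  shows "max_savings (\<lambda>x y. r (h x) (h y)) U \<le> max_savings r (h ` U)"
proof -
  obtain P where P: "packing (\<lambda>x y. r (h x) (h y)) U P"
    "savings P = max_savings (\<lambda>x y. r (h x) (h y)) U"
    using max_savings_attained[OF assms(2)] by blast
  have sub: "K \<subseteq> U" if "K \<in> P" for K
    using packing_subset[OF P(1) that] .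
  have card: "card (h ` K) = card K" if "K \<subseteq> U" for K
    by (rule card_image[OF inj_on_subset[OF assms(1) that]])
  have inj: "inj_on ((`) h) P"
  proof (rule inj_onI)
    fix K L assume "K \<in> P" "L \<in> P" "h ` K = h ` L"
    then show "K = L" using inj_on_image_eq_iff[OF assms(1) sub sub] by blast
  qed
  have "packing r (h ` U) ((`) h ` P)"
    unfolding packing_def
  proof (intro conjI ballI impI)
    fix K assume "K \<in> (`) h ` P"
    then obtain K' where K': "K = h ` K'" "K' \<in> P" by blast
    then show "K \<subseteq> h ` U" "2 \<le> card K"
      using packing_card[OF P(1) K'(2)] sub[OF K'(2)] by (auto simp: card[OF sub[OF K'(2)]])
    have "homogeneous (\<lambda>x y. r (h x) (h y)) K'"
      using packing_homogeneous[OF P(1) K'(2)] .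
    then obtain c where "\<forall>x\<in>K'. \<forall>y\<in>K'. x \<noteq> y \<longrightarrow> r (h x) (h y) = c"
      unfolding homogeneous_def by blast
    then show "homogeneous r K"
      unfolding homogeneous_def K'(1) by (intro exI[of _ c]) auto
  next
    fix K L assume KL: "K \<in> (`) h ` P" "L \<in> (`) h ` P" "K \<noteq> L"
    then obtain K' L' where *: "K = h ` K'" "K' \<in> P" "L = h ` L'" "L' \<in> P" by blast
    have "K \<inter> L = h ` (K' \<inter> L')"
      unfolding * using inj_on_image_Int[OF assms(1) sub[OF *(2)] sub[OF *(4)]] by simp
    moreover have "card (K' \<inter> L') \<le> 1"
      using packing_meet[OF P(1) *(2,4)] KL(3) * by blast
    moreover have "card (h ` (K' \<inter> L')) = card (K' \<inter> L')"
      using sub[OF *(2)] by (intro card) blast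
    ultimately show "card (K \<inter> L) \<le> 1" by simp
  qed
  moreover have "savings ((`) h ` P) = savings P"
    unfolding savings_def sum.reindex[OF inj] using card[OF sub] by simp
  ultimately show ?thesis
    using savings_le_max[of "h ` U" r "(`) h ` P"] assms(2) P(2) by simp
qed

text \<open>Comparing with \<open>k\<close> keeps or exchanges the two colours, so any chosen colour
  can be renamed \<open>True\<close>.\<close>

lemma homogeneous_flip: "homogeneous (\<lambda>x y. r x y = k) K \<longleftrightarrow> homogeneous r K"
  by (cases k) (auto simp: homogeneous_def ex_bool_eq)

lemma max_savings_flip: "max_savings (\<lambda>x y. r x y = k) V = max_savings r V"
  by (simp add: max_savings_def packing_def homogeneous_flip)

lemma max_savings_cong:
  assumes "\<And>x y. x \<noteq> y \<Longrightarrow> r x y = s x y"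
  shows "max_savings r V = max_savings s V"
proof -
  have "homogeneous r K = homogeneous s K" for K
    using assms by (simp add: homogeneous_def cong: ball_cong)
  then show ?thesis by (simp add: max_savings_def packing_def)
qed

section \<open>From packings to clique partitions\<close>

lemma card_nsets_two: "finite K \<Longrightarrow> 2 * card ([K]\<^bsup>2\<^esup>) = card K * (card K - 1)"
  by (cases "card K") (simp_all add: choose_two)

lemma sum_card_le_scp:
  assumes "clique_partition V E P" shows "scp V E \<le> (\<Sum>C\<in>P. card C)"
  unfolding scp_def by (rule Least_le) (use assms in blast)

text \<open>The cliques of a packing, completed by the uncovered edges, form a clique partition;
  a clique on \<open>k\<close> vertices replaces its \<open>k (k - 1) / 2\<close> edges, of total cost \<open>k (k - 1)\<close>, at
  the price \<open>k\<close>, which saves \<open>k (k - 2)\<close>.\<close>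

lemma scp_packing:
  assumes G: "fin_simple_graph V E" and fin: "finite Q"
    and Q: "\<And>K. K \<in> Q \<Longrightarrow> K \<subseteq> V \<and> 2 \<le> card K \<and> clique K E"
    and meet: "\<And>K L. K \<in> Q \<Longrightarrow> L \<in> Q \<Longrightarrow> K \<noteq> L \<Longrightarrow> card (K \<inter> L) \<le> 1"
  shows "scp V E + savings Q \<le> 2 * card E"
proof -
  have V: "finite V" and E: "E \<subseteq> [V]\<^bsup>2\<^esup>"
    using G by (auto simp: fin_simple_graph_def)
  have finE: "finite E" using E V finite_imp_finite_nsets finite_subset by metis
  have finK: "finite K" if "K \<in> Q" for K using Q[OF that] V finite_subset by blast
  define U where "U = (\<Union>K\<in>Q. [K]\<^bsup>2\<^esup>)"
  have UE: "U \<subseteq> E"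
  proof
    fix e assume "e \<in> U"
    then obtain K where "K \<in> Q" "e \<subseteq> K" "card e = 2" by (auto simp: U_def nsets_def)
    then show "e \<in> E" using Q by (fastforce simp: clique_def card_2_iff)
  qed
  have unique: "K = L" if "K \<in> Q" "L \<in> Q" "e \<subseteq> K" "e \<subseteq> L" "card e = 2" for e K L
  proof (rule ccontr)
    assume "K \<noteq> L"
    then have "card (K \<inter> L) \<le> 1" using meet that by blast
    moreover have "card e \<le> card (K \<inter> L)"
      using that finK by (intro card_mono) auto
    ultimately show False using that by simp
  qed
  have card2: "card e = 2" if "e \<in> E" for e using E that by (auto simp: nsets_def)
  have fine: "finite e" if "e \<in> E" for e using E that by (auto simp: nsets_def)
  have part: "clique_partition V E (Q \<union> (E - U))"
    unfolding clique_partition_def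
  proof (intro conjI ballI)
    fix C assume "C \<in> Q \<union> (E - U)"
    then show "C \<subseteq> V" "clique C E"
      using Q E by (auto simp: nsets_def clique_def card_2_iff insert_commute)
  next
    fix e assume e: "e \<in> E"
    show "\<exists>!C. C \<in> Q \<union> (E - U) \<and> e \<subseteq> C"
    proof (cases "e \<in> U")
      case True
      then obtain K where K: "K \<in> Q" "e \<subseteq> K" by (auto simp: U_def nsets_def)
      show ?thesis
      proof (rule ex1I[of _ K])
        fix C assume C: "C \<in> Q \<union> (E - U) \<and> e \<subseteq> C"
        have "C \<in> Q"
        proof (rule ccontr)
          assume "C \<notin> Q"
          then have "C \<in> E - U" using C by blast
          then have "C = e" using C card2 e fine by (metis DiffD1 card_subset_eq)
          then show False using True \<open>C \<in> E - U\<close> by blast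
        qed
        then show "C = K" using unique K C card2[OF e] by blast
      qed (use K in simp)
    next
      case False
      show ?thesis
      proof (rule ex1I[of _ e])
        fix C assume C: "C \<in> Q \<union> (E - U) \<and> e \<subseteq> C"
        have "C \<notin> Q" using False C card2[OF e] fine[OF e] by (auto simp: U_def nsets_def)
        then show "C = e" using C card2 e fine by (metis DiffD1 Un_iff card_subset_eq)
      qed (use e False in simp)
    qed
  qed
  have cardU: "card U = (\<Sum>K\<in>Q. card ([K]\<^bsup>2\<^esup>))"
    unfolding U_def
  proof (rule card_UN_disjoint[OF fin])
    show "\<forall>K\<in>Q. finite ([K]\<^bsup>2\<^esup>)" using finK finite_imp_finite_nsets by blast
    show "\<forall>K\<in>Q. \<forall>L\<in>Q. K \<noteq> L \<longrightarrow> [K]\<^bsup>2\<^esup> \<inter> [L]\<^bsup>2\<^esup> = {}"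
      using unique by (auto simp: nsets_def)
  qed
  have "(\<Sum>C\<in>Q \<union> (E - U). card C) \<le> (\<Sum>C\<in>Q. card C) + (\<Sum>C\<in>E - U. card C)"
    using fin finE by (simp add: sum_Un_nat)
  also have "(\<Sum>C\<in>E - U. card C) = 2 * (card E - card U)"
    using card2 finE UE by (simp add: card_Diff_subset finite_subset)
  finally have "scp V E \<le> (\<Sum>C\<in>Q. card C) + 2 * (card E - card U)"
    using sum_card_le_scp[OF part] by linarith
  moreover have "card U \<le> card E" using UE finE by (rule card_mono[rotated])
  moreover have "(\<Sum>C\<in>Q. card C) + savings Q = 2 * card U"
    unfolding savings_def cardU sum_distrib_left sum.distrib[symmetric]
  proof (rule sum.cong[OF refl])
    fix K assume "K \<in> Q"
    then have "2 \<le> card K" using Q by blast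
    then obtain m where "card K = m + 2" by (metis add.commute le_iff_add)
    then show "card K + card K * (card K - 2) = 2 * card ([K]\<^bsup>2\<^esup>)"
      unfolding card_nsets_two[OF finK[OF \<open>K \<in> Q\<close>]] by simp
  qed
  ultimately show ?thesis by linarith
qed

text \<open>The packing is split by colour: its cliques of \<open>E\<close> lower the first summand,
  the remaining members are cliques of the complement and lower the second. Without savings the cost
  is twice the number of all pairs.\<close>

lemma scp_complement_sum:
  assumes G: "fin_simple_graph V E"
  shows "scp V E + scp V (complement_edges V E) + max_savings (\<lambda>x y. {x, y} \<in> E) V
    \<le> card V * (card V - 1)"
proof -
  have V: "finite V" and E: "E \<subseteq> [V]\<^bsup>2\<^esup>"
    using G by (auto simp: fin_simple_graph_def)
  let ?E' = "complement_edges V E"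
  have G': "fin_simple_graph V ?E'"
    using V by (auto simp: fin_simple_graph_def complement_edges_def)
  obtain P where P: "packing (\<lambda>x y. {x, y} \<in> E) V P"
    and sav: "savings P = max_savings (\<lambda>x y. {x, y} \<in> E) V"
    using max_savings_attained[OF V] by blast
  have fin: "finite P" using finite_packing V P by blast
  define Q where "Q = {K \<in> P. clique K E}"
  define Q' where "Q' = P - Q"
  have "scp V E + savings Q \<le> 2 * card E"
    by (rule scp_packing[OF G])
      (use fin packing_subset[OF P] packing_card[OF P] packing_meet[OF P] in \<open>auto simp: Q_def\<close>)
  moreover have "scp V ?E' + savings Q' \<le> 2 * card ?E'"
  proof (rule scp_packing[OF G'])
    fix K assume K: "K \<in> Q'"
    then have KP: "K \<subseteq> V" "2 \<le> card K" "homogeneous (\<lambda>x y. {x, y} \<in> E) K" "\<not> clique K E"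
      using packing_subset[OF P] packing_card[OF P] packing_homogeneous[OF P]
      by (auto simp: Q_def Q'_def)
    \<comment> \<open>Some pair in \<open>K\<close> is not an edge, and by homogeneity then no pair
      is.\<close>
    then have "{x, y} \<notin> E" if "x \<in> K" "y \<in> K" "x \<noteq> y" for x y
      using that unfolding clique_def homogeneous_def by metis
    then have "clique K ?E'"
      using KP(1) by (auto simp: clique_def complement_edges_def nsets_def)
    then show "K \<subseteq> V \<and> 2 \<le> card K \<and> clique K ?E'" using KP by blast
  qed (use fin packing_meet[OF P] in \<open>auto simp: Q_def Q'_def\<close>)
  moreover have "savings P = savings Q + savings Q'"
    unfolding savings_def Q'_def using fin
    by (subst sum.subset_diff[of Q P]) (auto simp: Q_def)
  moreover have "card ?E' = card ([V]\<^bsup>2\<^esup>) - card E" "card E \<le> card ([V]\<^bsup>2\<^esup>)"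
    unfolding complement_edges_def
    using E V by (meson card_Diff_subset card_mono finite_imp_finite_nsets finite_subset)+
  ultimately show ?thesis
    using card_nsets_two[OF V] sav by linarith
qed

section \<open>The flag algebra form\<close>

text \<open>A flag consists of an edge \<open>x y\<close> and two further vertices \<open>u\<close>, \<open>v\<close>. It is described by the truth
  values telling which of \<open>x u\<close>, \<open>y u\<close>, \<open>x v\<close>, \<open>y v\<close>, \<open>u v\<close> have the colour of \<open>x y\<close>; up to exchanging
  \<open>x\<close> with \<open>y\<close> and \<open>u\<close> with \<open>v\<close> there are 14 flags, seven for each value of the last one. The three
  weight vectors are a rounded numerical solution of rank three of the semidefinite program.\<close>

definition select :: "bool \<Rightarrow> bool \<Rightarrow> bool \<Rightarrow> bool \<Rightarrow> int \<Rightarrow> int \<Rightarrow> int \<Rightarrow> int \<Rightarrow> int \<Rightarrow> int \<Rightarrow> int \<Rightarrow> int"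
  where "select a b c d z0 z1 z2 z3 z4 z5 z6 =
    (if a = b then
       if c = d then if a then if c then z0 else z4 else if c then z4 else z6
       else if a then z1 else z5
     else if c = d then if c then z1 else z5
     else if a = c then z2 else z3)"

definition flag1 :: "bool \<Rightarrow> bool \<Rightarrow> bool \<Rightarrow> bool \<Rightarrow> bool \<Rightarrow> int"
  where "flag1 a b c d e =
    (if e then select a b c d (-3) (-2) (-3) 6 5 9 12
     else select a b c d (-1) (-14) 2 6 (-8) (-5) (-9))"

definition flag2 :: "bool \<Rightarrow> bool \<Rightarrow> bool \<Rightarrow> bool \<Rightarrow> bool \<Rightarrow> int"
  where "flag2 a b c d e =
    (if e then select a b c d 12 0 (-2) (-4) (-7) (-10) (-12)
     else select a b c d 14 11 6 3 2 (-1) (-11))"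

definition flag3 :: "bool \<Rightarrow> bool \<Rightarrow> bool \<Rightarrow> bool \<Rightarrow> bool \<Rightarrow> int"
  where "flag3 a b c d e =
    (if e then select a b c d 2 (-3) 3 4 (-1) 14 15
     else select a b c d (-12) (-4) (-8) (-11) (-2) (-1) 9)"

lemmas flag_defs = flag1_def flag2_def flag3_def select_def

definition flag_prod :: "bool \<Rightarrow> bool \<Rightarrow> bool \<Rightarrow> bool \<Rightarrow> bool \<Rightarrow> bool \<Rightarrow> bool \<Rightarrow> bool \<Rightarrow> bool \<Rightarrow> bool \<Rightarrow> int"
  where "flag_prod xu yu xv yv uv xw yw xz yz wz =
    flag1 xu yu xv yv uv * flag1 xw yw xz yz wz +
    flag2 xu yu xv yv uv * flag2 xw yw xz yz wz +
    flag3 xu yu xv yv uv * flag3 xw yw xz yz wz"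

text \<open>The summands are the three ways to split \<open>u\<close>, \<open>v\<close>,
  \<open>w\<close>, \<open>z\<close> into two pairs, that is, into two flags on the common edge
  \<open>x y\<close>.\<close>

definition edge_form :: "bool \<Rightarrow> bool \<Rightarrow> bool \<Rightarrow> bool \<Rightarrow> bool \<Rightarrow> bool \<Rightarrow> bool \<Rightarrow> bool \<Rightarrow>
    bool \<Rightarrow> bool \<Rightarrow> bool \<Rightarrow> bool \<Rightarrow> bool \<Rightarrow> bool \<Rightarrow> int"
  where "edge_form xu yu xv yv xw yw xz yz uv uw uz vw vz wz =
    flag_prod xu yu xv yv uv xw yw xz yz wz +
    flag_prod xu yu xw yw uw xv yv xz yz vz +
    flag_prod xu yu xz yz uz xv yv xw yw vw"

text \<open>All colours are read relative to that of \<open>x y\<close>, so exchanging the two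
  colours changes nothing.\<close>

definition edge_term :: "('a \<Rightarrow> 'a \<Rightarrow> bool) \<Rightarrow> 'a \<Rightarrow> 'a \<Rightarrow> 'a \<Rightarrow> 'a \<Rightarrow> 'a \<Rightarrow> 'a \<Rightarrow> int"
  where "edge_term r x y u v w z =
    edge_form (r x u = r x y) (r y u = r x y) (r x v = r x y) (r y v = r x y)
      (r x w = r x y) (r y w = r x y) (r x z = r x y) (r y z = r x y)
      (r u v = r x y) (r u w = r x y) (r u z = r x y)
      (r v w = r x y) (r v z = r x y) (r w z = r x y)"

definition flag_sum :: "('a \<Rightarrow> 'a \<Rightarrow> bool) \<Rightarrow> 'a \<Rightarrow> 'a \<Rightarrow> 'a \<Rightarrow> 'a \<Rightarrow> 'a \<Rightarrow> 'a \<Rightarrow> int"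
  where "flag_sum r a b c d e f =
    edge_term r a b c d e f + edge_term r a c b d e f + edge_term r a d b c e f +
    edge_term r a e b c d f + edge_term r a f b c d e + edge_term r b c a d e f +
    edge_term r b d a c e f + edge_term r b e a c d f + edge_term r b f a c d e +
    edge_term r c d a b e f + edge_term r c e a b d f + edge_term r c f a b d e +
    edge_term r d e a b c f + edge_term r d f a b c e + edge_term r e f a b c d"

section \<open>Invariance of the form under permutations of the six points\<close>

lemma flag_swap_ends:
  "flag1 b a d c e = flag1 a b c d e" "flag2 b a d c e = flag2 a b c d e" "flag3 b a d c e = flag3 a b c d e"
  by (cases a; cases b; cases c; cases d; simp add: flag_defs)+

lemma flag_swap_pair:
  "flag1 c d a b e = flag1 a b c d e" "flag2 c d a b e = flag2 a b c d e" "flag3 c d a b e = flag3 a b c d e"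
  by (cases a; cases b; cases c; cases d; simp add: flag_defs)+

lemma flag_prod_swap_ends:
  "flag_prod yu xu yv xv uv yw xw yz xz wz = flag_prod xu yu xv yv uv xw yw xz yz wz"
  unfolding flag_prod_def by (simp only: flag_swap_ends)

lemma flag_prod_swap_left:
  "flag_prod xv yv xu yu uv xw yw xz yz wz = flag_prod xu yu xv yv uv xw yw xz yz wz"
  unfolding flag_prod_def by (simp only: flag_swap_pair)

lemma flag_prod_swap_right:
  "flag_prod xu yu xv yv uv xz yz xw yw wz = flag_prod xu yu xv yv uv xw yw xz yz wz"
  unfolding flag_prod_def by (simp only: flag_swap_pair)

lemma flag_prod_commute:
  "flag_prod xw yw xz yz wz xu yu xv yv uv = flag_prod xu yu xv yv uv xw yw xz yz wz"
  unfolding flag_prod_def by (simp only: mult.commute)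

context
  fixes r :: "'a \<Rightarrow> 'a \<Rightarrow> bool"
  assumes sym: "\<And>x y. r x y = r y x"
begin

lemma edge_term_swap_ends: "edge_term r y x u v w z = edge_term r x y u v w z"
  unfolding edge_term_def edge_form_def sym[of y x] by (simp only: flag_prod_swap_ends)

lemma edge_term_swap_uv: "edge_term r x y v u w z = edge_term r x y u v w z"
proof -
  have "flag_prod (r x v = r x y) (r y v = r x y) (r x w = r x y) (r y w = r x y) (r v w = r x y)
      (r x u = r x y) (r y u = r x y) (r x z = r x y) (r y z = r x y) (r u z = r x y) =
    flag_prod (r x u = r x y) (r y u = r x y) (r x z = r x y) (r y z = r x y) (r u z = r x y)
      (r x v = r x y) (r y v = r x y) (r x w = r x y) (r y w = r x y) (r v w = r x y)"
    by (rule flag_prod_commute)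
  moreover have "flag_prod (r x v = r x y) (r y v = r x y) (r x z = r x y) (r y z = r x y) (r v z = r x y)
      (r x u = r x y) (r y u = r x y) (r x w = r x y) (r y w = r x y) (r u w = r x y) =
    flag_prod (r x u = r x y) (r y u = r x y) (r x w = r x y) (r y w = r x y) (r u w = r x y)
      (r x v = r x y) (r y v = r x y) (r x z = r x y) (r y z = r x y) (r v z = r x y)"
    by (rule flag_prod_commute)
  ultimately show ?thesis
    unfolding edge_term_def edge_form_def sym[of v u] by (simp add: flag_prod_swap_left)
qed

lemma edge_term_swap_vw: "edge_term r x y u w v z = edge_term r x y u v w z"
  unfolding edge_term_def edge_form_def sym[of w v] by (simp add: flag_prod_swap_right)

lemma edge_term_swap_wz: "edge_term r x y u v z w = edge_term r x y u v w z"
  unfolding edge_term_def edge_form_def sym[of z w] by (simp add: flag_prod_swap_right)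

text \<open>Adjacent transpositions generate all permutations, so these five identities give full
  symmetry. Each of them only permutes the fifteen edge terms, up to the symmetries of a single
  term.\<close>

lemma flag_sum_swaps:
  "flag_sum r b a c d e f = flag_sum r a b c d e f"
  "flag_sum r a c b d e f = flag_sum r a b c d e f"
  "flag_sum r a b d c e f = flag_sum r a b c d e f"
  "flag_sum r a b c e d f = flag_sum r a b c d e f"
  "flag_sum r a b c d f e = flag_sum r a b c d e f"
proof -
  note swap = edge_term_swap_uv edge_term_swap_vw edge_term_swap_wz
  show "flag_sum r b a c d e f = flag_sum r a b c d e f"
    unfolding flag_sum_def edge_term_swap_ends[of b a] swap(1)[of _ _ b a] by simp
  show "flag_sum r a c b d e f = flag_sum r a b c d e f"
    unfolding flag_sum_def edge_term_swap_ends[of c b] swap(1)[of _ _ c b] swap(2)[of _ _ _ c b] by simp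
  show "flag_sum r a b d c e f = flag_sum r a b c d e f"
    unfolding flag_sum_def edge_term_swap_ends[of d c] swap(1)[of _ _ d c] swap(2)[of _ _ _ d c]
      swap(3)[of _ _ _ _ d c] by simp
  show "flag_sum r a b c e d f = flag_sum r a b c d e f"
    unfolding flag_sum_def edge_term_swap_ends[of e d] swap(1)[of _ _ e d] swap(2)[of _ _ _ e d]
      swap(3)[of _ _ _ _ e d] by simp
  show "flag_sum r a b c d f e = flag_sum r a b c d e f"
    unfolding flag_sum_def edge_term_swap_ends[of f e] swap(1)[of _ _ f e] swap(2)[of _ _ _ f e]
      swap(3)[of _ _ _ _ f e] by simp
qed

end

fun flag_sum_list :: "('a \<Rightarrow> 'a \<Rightarrow> bool) \<Rightarrow> 'a list \<Rightarrow> int"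
  where
    "flag_sum_list r [a, b, c, d, e, f] = flag_sum r a b c d e f"
  | "flag_sum_list r _ = 0"

lemma length_six: "length xs = 6 \<longleftrightarrow> (\<exists>a b c d e f. xs = [a, b, c, d, e, f])"
  by (auto simp: numeral_eq_Suc length_Suc_conv)

lemma flag_sum_list_swap:
  assumes "\<And>x y. r x y = r y x" "length (ps @ y # x # xs) = 6"
  shows "flag_sum_list r (ps @ y # x # xs) = flag_sum_list r (ps @ x # y # xs)"
proof -
  have "length ps < 5" using assms(2) by simp
  then consider "ps = []" | "\<exists>a. ps = [a]" | "\<exists>a b. ps = [a, b]" | "\<exists>a b c. ps = [a, b, c]"
    | "\<exists>a b c d. ps = [a, b, c, d]"
    \<comment> \<open>The rule only serves to distinguish lists with no, one, or at least two
      elements.\<close>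
    by (cases ps rule: remdups_adj.cases; fastforce simp: numeral_eq_Suc less_Suc_eq length_Suc_conv)
  then show ?thesis
    using assms(2) flag_sum_swaps[of r, OF assms(1)]
    by cases (auto simp: numeral_eq_Suc length_Suc_conv)
qed

text \<open>Adjacent exchanges bring the head of \<open>xs\<close> to the front of
  \<open>ys\<close>; then the tails are compared by induction, with the prefix \<open>ps\<close>
  collecting the positions already settled.\<close>

lemma adjacent_swaps_imp_perm_invariant:
  assumes swap: "\<And>ps x y qs. length (ps @ x # y # qs) = n \<Longrightarrow> F (ps @ x # y # qs) = F (ps @ y # x # qs)"
    and "mset xs = mset ys" "length xs = n"
  shows "F xs = F ys"
proof -
  have move: "F (ps @ us @ x # vs) = F (ps @ x # us @ vs)" if "length (ps @ us @ x # vs) = n" for ps us x vs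
    using that
  proof (induction us arbitrary: ps)
    case (Cons u us)
    then have "F (ps @ (u # us) @ x # vs) = F (ps @ u # x # us @ vs)"
      using Cons.IH[of "ps @ [u]"] by simp
    also have "\<dots> = F (ps @ x # u # us @ vs)"
      using swap[of ps u x "us @ vs"] Cons.prems by simp
    finally show ?case by simp
  qed simp
  have "F (ps @ xs) = F (ps @ ys)" if "mset xs = mset ys" "length (ps @ xs) = n" for ps
    using that
  proof (induction xs arbitrary: ps ys)
    case (Cons x xs)
    then have "x \<in> set ys" by (metis list.set_intros(1) mset_eq_setD)
    then obtain us vs where ys: "ys = us @ x # vs" by (meson split_list)
    then have eq: "mset xs = mset (us @ vs)" using Cons.prems(1) by simp
    then have len: "length xs = length (us @ vs)" by (rule mset_eq_length)
    have "F (ps @ x # xs) = F (ps @ x # us @ vs)"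
      using Cons.IH[of "us @ vs" "ps @ [x]"] eq Cons.prems(2) by simp
    also have "\<dots> = F (ps @ ys)"
      using move[of ps us x vs] ys len Cons.prems(2) by simp
    finally show ?case .
  qed simp
  from this[of "[]"] show ?thesis using assms(2,3) by simp
qed

lemma flag_sum_list_perm:
  assumes "\<And>x y. r x y = r y x" "mset xs = mset ys" "length xs = 6"
  shows "flag_sum_list r xs = flag_sum_list r ys"
  by (rule adjacent_swaps_imp_perm_invariant[OF _ assms(2,3)])
    (rule flag_sum_list_swap[OF assms(1)], simp)

section \<open>The bound for six points\<close>

datatype point = P1 | P2 | P3 | P4 | P5 | P6

text \<open>Up to the names of colours and vertices, the first three points span a triangle of colour
  \<open>True\<close>, and the other three are sorted by the colours of their edges to the triangle.\<close>

fun point_colour :: "bool \<Rightarrow> bool \<Rightarrow> bool \<Rightarrow> bool \<Rightarrow> bool \<Rightarrow> bool \<Rightarrow> bool \<Rightarrow> bool \<Rightarrow> bool \<Rightarrow>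
    bool \<Rightarrow> bool \<Rightarrow> bool \<Rightarrow> point \<Rightarrow> point \<Rightarrow> bool"
  where "point_colour ad bd cd ae be ce af bf cf de df ef x y =
    (case x of
      P1 \<Rightarrow> (case y of P4 \<Rightarrow> ad | P5 \<Rightarrow> ae | P6 \<Rightarrow> af | _ \<Rightarrow> True)
    | P2 \<Rightarrow> (case y of P4 \<Rightarrow> bd | P5 \<Rightarrow> be | P6 \<Rightarrow> bf | _ \<Rightarrow> True)
    | P3 \<Rightarrow> (case y of P4 \<Rightarrow> cd | P5 \<Rightarrow> ce | P6 \<Rightarrow> cf | _ \<Rightarrow> True)
    | P4 \<Rightarrow> (case y of P1 \<Rightarrow> ad | P2 \<Rightarrow> bd | P3 \<Rightarrow> cd | P5 \<Rightarrow> de | P6 \<Rightarrow> df | _ \<Rightarrow> True)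
    | P5 \<Rightarrow> (case y of P1 \<Rightarrow> ae | P2 \<Rightarrow> be | P3 \<Rightarrow> ce | P4 \<Rightarrow> de | P6 \<Rightarrow> ef | _ \<Rightarrow> True)
    | P6 \<Rightarrow> (case y of P1 \<Rightarrow> af | P2 \<Rightarrow> bf | P3 \<Rightarrow> cf | P4 \<Rightarrow> df | P5 \<Rightarrow> ef | _ \<Rightarrow> True))"

section \<open>An executable search for packings on six points\<close>

fun all_colour :: "('a \<Rightarrow> 'a \<Rightarrow> bool) \<Rightarrow> bool \<Rightarrow> 'a list \<Rightarrow> bool"
  where
    "all_colour r c [] = True"
  | "all_colour r c (x # xs) = (if list_all (\<lambda>y. r x y = c) xs then all_colour r c xs else False)"

definition homogeneous_list :: "('a \<Rightarrow> 'a \<Rightarrow> bool) \<Rightarrow> 'a list \<Rightarrow> bool"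
  where "homogeneous_list r xs = (if all_colour r True xs then True else all_colour r False xs)"

definition almost_disjoint :: "'a list \<Rightarrow> 'a list \<Rightarrow> bool"
  where "almost_disjoint K L = (case filter (\<lambda>x. x \<in> set L) K of x # y # zs \<Rightarrow> False | _ \<Rightarrow> True)"

text \<open>The target \<open>t\<close> is 467 times the wanted savings. The nested conditionals, here and below, make
  the simplifier evaluate lazily.\<close>

function attains :: "'a list list \<Rightarrow> int \<Rightarrow> bool"
  where
    "attains [] t = (t \<le> 0)"
  | "attains (K # Ks) t =
      (if t \<le> 0 then True
       else if attains (filter (almost_disjoint K) Ks) (t - 467 * (int (length K) * (int (length K) - 2)))
         then True else attains Ks t)"
  by pat_completeness auto
termination
  by (relation "measure (length \<circ> fst)") (auto simp: le_imp_less_Suc)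

definition holds_for_both :: "(bool \<Rightarrow> bool) \<Rightarrow> bool"
  where "holds_for_both P = (if P True then P False else False)"

lemma holds_for_both_iff: "holds_for_both P \<longleftrightarrow> (\<forall>b. P b)"
  by (auto simp: holds_for_both_def all_bool_eq)

text \<open>The three colours towards the triangle are read as a binary number. Sorting the last
  three points by it leaves 120 of the 512 triples of types.\<close>

definition rank :: "bool \<Rightarrow> bool \<Rightarrow> bool \<Rightarrow> int"
  where "rank a b c = (if a then 4 else 0) + (if b then 2 else 0) + (if c then 1 else 0)"

text \<open>Pairs save nothing, so the search starts with cliques on three points.\<close>

definition subcliques :: "(point \<Rightarrow> point \<Rightarrow> bool) \<Rightarrow> point list list"
  where "subcliques r = filter (homogeneous_list r) (filter (\<lambda>K. 3 \<le> length K) (subseqs [P1, P2, P3, P4, P5, P6]))"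

definition good :: "(point \<Rightarrow> point \<Rightarrow> bool) \<Rightarrow> bool"
  where "good r = attains (subcliques r) (flag_sum r P1 P2 P3 P4 P5 P6 + 467 * 7)"

definition all_good :: bool
  where "all_good =
    holds_for_both (\<lambda>ad. holds_for_both (\<lambda>bd. holds_for_both (\<lambda>cd.
    holds_for_both (\<lambda>ae. holds_for_both (\<lambda>be. holds_for_both (\<lambda>ce.
      if rank ad bd cd \<le> rank ae be ce then
    holds_for_both (\<lambda>af. holds_for_both (\<lambda>bf. holds_for_both (\<lambda>cf.
      if rank ae be ce \<le> rank af bf cf then
    holds_for_both (\<lambda>de. holds_for_both (\<lambda>df. holds_for_both (\<lambda>ef.
      good (point_colour ad bd cd ae be ce af bf cf de df ef))))
      else True)))
      else True))))))"

text \<open>An exhaustive evaluation of 960 colourings: 120 sorted triples of types, times 8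
  colourings of the edges among the last three points.\<close>

lemma all_good: all_good
  by code_simp

section \<open>Soundness of the search\<close>

lemma all_colour_iff:
  assumes "\<And>x y. r x y = r y x" "distinct xs"
  shows "all_colour r c xs \<longleftrightarrow> (\<forall>x\<in>set xs. \<forall>y\<in>set xs. x \<noteq> y \<longrightarrow> r x y = c)"
  using assms(2)
proof (induction xs)
  case (Cons x xs)
  then show ?case using assms(1) by (auto simp: list_all_iff)
qed simp

lemma homogeneous_list_iff:
  assumes "\<And>x y. r x y = r y x" "distinct xs"
  shows "homogeneous_list r xs \<longleftrightarrow> homogeneous r (set xs)"
  by (auto simp: homogeneous_list_def homogeneous_def all_colour_iff[OF assms] ex_bool_eq)

lemma almost_disjoint_card:
  assumes "almost_disjoint K L" shows "card (set K \<inter> set L) \<le> 1"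
proof -
  have "length (filter (\<lambda>x. x \<in> set L) K) \<le> 1"
    using assms by (auto simp: almost_disjoint_def split: list.splits)
  moreover have "set K \<inter> set L = set (filter (\<lambda>x. x \<in> set L) K)" by auto
  ultimately show ?thesis by (metis card_length le_trans)
qed

text \<open>The search either takes \<open>K\<close> and keeps only the later cliques almost
  disjoint from it, or skips \<open>K\<close>. That \<open>P\<close> consists of listed cliques is
  what allows \<open>K\<close> to be added to it.\<close>

lemma attains_sound:
  assumes "attains Ks t" "\<forall>K\<in>set Ks. distinct K \<and> 3 \<le> length K \<and> homogeneous r (set K)"
  shows "\<exists>P. packing r UNIV P \<and> P \<subseteq> set ` set Ks \<and> t \<le> 467 * int (savings P)"
  using assms
proof (induction Ks t rule: attains.induct)
  case (1 t)
  then show ?case by (intro exI[of _ "{}"]) (simp add: packing_empty savings_def)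
next
  case (2 K Ks t)
  let ?Ks = "filter (almost_disjoint K) Ks"
  let ?t = "t - 467 * (int (length K) * (int (length K) - 2))"
  have K: "distinct K" "3 \<le> length K" "homogeneous r (set K)" using "2.prems"(2) by auto
  consider "t \<le> 0" | "\<not> t \<le> 0" "attains ?Ks ?t" | "\<not> t \<le> 0" "\<not> attains ?Ks ?t" "attains Ks t"
    using "2.prems"(1) by (auto split: if_splits)
  then show ?case
  proof cases
    case 1
    then show ?thesis by (intro exI[of _ "{}"]) (simp add: packing_empty savings_def)
  next
    case 2
    have "\<forall>K\<in>set ?Ks. distinct K \<and> 3 \<le> length K \<and> homogeneous r (set K)"
      using "2.prems"(2) by simp
    then obtain P where P: "packing r UNIV P" "P \<subseteq> set ` set ?Ks" "?t \<le> 467 * int (savings P)"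
      using "2.IH"(1)[OF 2] by blast
    have fin: "finite P" using P(2) finite_subset by blast
    have card: "card (set K) = length K" using K(1) by (rule distinct_card)
    have meet: "card (set K \<inter> L) \<le> 1" if "L \<in> P" for L
      using that P(2) almost_disjoint_card[of K] by auto
    \<comment> \<open>Otherwise \<open>K\<close>, which has at least three points, would meet itself
      in at most one.\<close>
    then have new: "set K \<notin> P" using card K(2) by fastforce
    have "packing r UNIV (insert (set K) P)"
      unfolding packing_def
    proof (intro conjI ballI impI)
      fix L M assume LM: "L \<in> insert (set K) P" "M \<in> insert (set K) P" "L \<noteq> M"
      then consider "L = set K" "M \<in> P" | "L \<in> P" "M = set K" | "L \<in> P" "M \<in> P" by blast
      then show "card (L \<inter> M) \<le> 1"
        by cases (use meet packing_meet[OF P(1)] LM(3) in \<open>simp_all add: Int_commute\<close>)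
    next
      fix L assume "L \<in> insert (set K) P"
      then show "L \<subseteq> UNIV" "2 \<le> card L" "homogeneous r L"
        using K card packing_card[OF P(1)] packing_homogeneous[OF P(1)] by auto
    qed
    moreover have "insert (set K) P \<subseteq> set ` set (K # Ks)" using P(2) by auto
    moreover have "int (savings (insert (set K) P)) = int (length K) * (int (length K) - 2) + int (savings P)"
      unfolding savings_def using fin new card K(2) by (simp add: of_nat_diff)
    ultimately show ?thesis using P(3)
      by (intro exI[of _ "insert (set K) P"]) (simp add: algebra_simps)
  next
    case 3
    then obtain P where "packing r UNIV P" "P \<subseteq> set ` set Ks" "t \<le> 467 * int (savings P)"
      using "2.IH"(2)[OF 3(1,2,3)] "2.prems"(2) by auto
    then show ?thesis by (intro exI[of _ P]) auto
  qed
qed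

lemma UNIV_point: "UNIV = {P1, P2, P3, P4, P5, P6}"
  using point.exhaust by blast

instance point :: finite
  by standard (simp add: UNIV_point)

lemma good_sound:
  assumes "\<And>x y. r x y = r y x" "good r"
  shows "flag_sum r P1 P2 P3 P4 P5 P6 + 467 * 7 \<le> 467 * int (max_savings r UNIV)"
proof -
  have "\<forall>K\<in>set (subcliques r). distinct K \<and> 3 \<le> length K \<and> homogeneous r (set K)"
  proof
    fix K assume K: "K \<in> set (subcliques r)"
    then have *: "K \<in> set (subseqs [P1, P2, P3, P4, P5, P6])" "3 \<le> length K" "homogeneous_list r K"
      unfolding subcliques_def set_filter by blast+
    moreover have "distinct [P1, P2, P3, P4, P5, P6]" by simp
    ultimately have "distinct K" using subseqs_distinctD by blast
    then show "distinct K \<and> 3 \<le> length K \<and> homogeneous r (set K)"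
      using * homogeneous_list_iff[of r, OF assms(1)] by blast
  qed
  from attains_sound[OF assms(2)[unfolded good_def] this]
  obtain P where "packing r UNIV P" "flag_sum r P1 P2 P3 P4 P5 P6 + 467 * 7 \<le> 467 * int (savings P)"
    by blast
  moreover from this have "savings P \<le> max_savings r UNIV"
    by (intro savings_le_max) auto
  ultimately show ?thesis by linarith
qed

lemma point_colour_sym:
  "point_colour ad bd cd ae be ce af bf cf de df ef x y = point_colour ad bd cd ae be ce af bf cf de df ef y x"
  by (cases x; cases y) simp_all

lemma good_point_colour:
  assumes "rank ad bd cd \<le> rank ae be ce" "rank ae be ce \<le> rank af bf cf"
  shows "good (point_colour ad bd cd ae be ce af bf cf de df ef)"
proof -
  have "(if P then Q else True) = (P \<longrightarrow> Q)" for P Q by simp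
  then show ?thesis
    using all_good assms unfolding all_good_def holds_for_both_iff by (simp only: simp_thms)
qed

text \<open>Only pairs of distinct points enter the form. This matters because
  \<open>point_colour\<close> is \<open>True\<close> on the diagonal, where the given colouring is
  arbitrary.\<close>

lemma flag_sum_cong:
  assumes "\<And>x y. x \<noteq> y \<Longrightarrow> r x y = s x y" "distinct [a, b, c, d, e, f]"
  shows "flag_sum r a b c d e f = flag_sum s a b c d e f"
proof -
  have "a \<noteq> b" "a \<noteq> c" "a \<noteq> d" "a \<noteq> e" "a \<noteq> f" "b \<noteq> c" "b \<noteq> d" "b \<noteq> e" "b \<noteq> f"
    "c \<noteq> d" "c \<noteq> e" "c \<noteq> f" "d \<noteq> e" "d \<noteq> f" "e \<noteq> f"
    using assms(2) by simp_all
  note rs = this[THEN assms(1)] this[symmetric, THEN assms(1)]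
  show ?thesis unfolding flag_sum_def edge_term_def rs ..
qed

text \<open>The vertices are named \<open>P1\<close> to \<open>P6\<close> and the colour
  \<open>k\<close> of the triangle becomes \<open>True\<close>, which brings the colouring into the
  range of the exhaustive check.\<close>

lemma six_point_bound_sorted:
  fixes r :: "'a \<Rightarrow> 'a \<Rightarrow> bool"
  assumes sym: "\<And>x y. r x y = r y x" and dist: "distinct [a, b, c, d, e, f]"
    and mono: "r a b = k" "r a c = k" "r b c = k"
    and "rank (r a d = k) (r b d = k) (r c d = k) \<le> rank (r a e = k) (r b e = k) (r c e = k)"
      "rank (r a e = k) (r b e = k) (r c e = k) \<le> rank (r a f = k) (r b f = k) (r c f = k)"
  shows "flag_sum r a b c d e f + 467 * 7 \<le> 467 * int (max_savings r {a, b, c, d, e, f})"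
proof -
  define h where "h = case_point a b c d e f"
  define s where "s = (\<lambda>x y. r (h x) (h y) = k)"
  define p where "p = point_colour (r a d = k) (r b d = k) (r c d = k) (r a e = k) (r b e = k) (r c e = k)
    (r a f = k) (r b f = k) (r c f = k) (r d e = k) (r d f = k) (r e f = k)"
  have sp: "s x y = p x y" if "x \<noteq> y" for x y
    using that mono sym[of b a] sym[of c a] sym[of d a] sym[of e a] sym[of f a] sym[of c b] sym[of d b]
      sym[of e b] sym[of f b] sym[of d c] sym[of e c] sym[of f c] sym[of e d] sym[of f d] sym[of f e]
    by (cases x; cases y) (simp_all add: s_def p_def h_def)
  have inj: "inj h"
  proof (rule injI)
    fix x y assume "h x = h y"
    then show "x = y" using dist by (cases x; cases y) (auto simp: h_def)
  qed
  \<comment> \<open>The form only asks whether two colours agree, and renaming colours preserves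
    this.\<close>
  have eq: "((u = k) = (v = k)) = (u = v)" for u v by blast
  have "flag_sum r a b c d e f = flag_sum s P1 P2 P3 P4 P5 P6"
    by (simp add: flag_sum_def edge_term_def s_def h_def eq)
  also have "\<dots> = flag_sum p P1 P2 P3 P4 P5 P6"
    by (rule flag_sum_cong[OF sp]) simp_all
  finally have "flag_sum r a b c d e f + 467 * 7 \<le> 467 * int (max_savings p UNIV)"
    using good_sound[of p] good_point_colour[OF assms(6,7)] point_colour_sym by (simp add: p_def)
  also have "max_savings p UNIV = max_savings s UNIV"
    by (rule max_savings_cong) (simp add: sp)
  also have "\<dots> = max_savings (\<lambda>x y. r (h x) (h y)) UNIV"
    unfolding s_def by (rule max_savings_flip)
  finally have "flag_sum r a b c d e f + 467 * 7 \<le> 467 * int (max_savings (\<lambda>x y. r (h x) (h y)) UNIV)" .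
  moreover have "max_savings (\<lambda>x y. r (h x) (h y)) UNIV \<le> max_savings r (h ` UNIV)"
    by (rule max_savings_image[OF inj]) simp
  moreover have "h ` UNIV = {a, b, c, d, e, f}" by (simp add: UNIV_point h_def)
  ultimately show ?thesis by simp
qed

text \<open>Three of the five edges at \<open>a\<close> have one colour. Either an edge joining two
  of their ends has it too, or the three ends span a triangle of the other colour.\<close>

lemma ramsey_triangle:
  fixes r :: "'a \<Rightarrow> 'a \<Rightarrow> bool"
  assumes sym: "\<And>x y. r x y = r y x" and "distinct xs" "length xs = 6"
  obtains x y z where "{x, y, z} \<subseteq> set xs" "x \<noteq> y" "x \<noteq> z" "y \<noteq> z" "r x z = r x y" "r y z = r x y"
proof -
  obtain a b c d e f where xs: "xs = [a, b, c, d, e, f]" using assms(3) length_six by metis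
  have "\<exists>u v w. {u, v, w} \<subseteq> {b, c, d, e, f} \<and> distinct [u, v, w] \<and> r a u = r a v \<and> r a v = r a w"
    using assms(2) unfolding xs by simp (smt (verit, best))
  then obtain u v w where *: "{u, v, w} \<subseteq> {b, c, d, e, f}" "distinct [u, v, w]" "r a u = r a v" "r a v = r a w"
    by blast
  have a: "a \<notin> {u, v, w}" "{a, u, v, w} \<subseteq> set xs" using *(1) assms(2) unfolding xs by auto
  consider "r u v = r a u" | "r u w = r a u" | "r v w = r a u" | "r u v = r u w" "r v w = r u v"
    by (cases "r a u"; cases "r u v"; cases "r u w"; cases "r v w") auto
  then show thesis
  proof cases
    case 1
    then show ?thesis using that[of a u v] a * by auto
  next
    case 2
    then show ?thesis using that[of a u w] a * by auto
  next
    case 3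
    then show ?thesis using that[of a v w] a * by auto
  next
    case 4
    then show ?thesis using that[of u v w] a * by auto
  qed
qed

text \<open>The vertices are reordered, with a monochromatic triangle first and the others sorted by
  \<open>rank\<close>; the symmetry of the form makes this harmless.\<close>

lemma six_point_bound:
  fixes r :: "'a \<Rightarrow> 'a \<Rightarrow> bool"
  assumes sym: "\<And>x y. r x y = r y x" and "distinct xs" "length xs = 6"
  shows "flag_sum_list r xs + 467 * 7 \<le> 467 * int (max_savings r (set xs))"
proof -
  obtain x y z where xyz: "{x, y, z} \<subseteq> set xs" "x \<noteq> y" "x \<noteq> z" "y \<noteq> z" and mono: "r x z = r x y" "r y z = r x y"
    using ramsey_triangle[OF assms] .
  define key where "key v = rank (r x v = r x y) (r y v = r x y) (r z v = r x y)" for v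
  define ys where "ys = sort_key key (remove1 z (remove1 y (remove1 x xs)))"
  have remove: "mset (u # remove1 u vs) = mset vs" if "u \<in> set vs" for u and vs :: "'a list"
    using that by simp
  have "y \<in> set (remove1 x xs)" "z \<in> set (remove1 y (remove1 x xs))"
    using xyz by (simp_all add: in_set_remove1)
  then have mset: "mset (x # y # z # ys) = mset xs"
    using remove[of x xs] remove[of y "remove1 x xs"] remove[of z "remove1 y (remove1 x xs)"] xyz(1)
    by (simp add: ys_def)
  then have len: "length (x # y # z # ys) = 6" using assms(3) by (metis mset_eq_length)
  then obtain d e f where def: "ys = [d, e, f]" by (auto simp: numeral_eq_Suc length_Suc_conv)
  have "sorted (map key ys)" by (simp add: ys_def)
  then have sorted: "key d \<le> key e" "key e \<le> key f" by (simp_all add: def)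
  have "distinct (x # y # z # ys)" using mset assms(2) by (metis mset_eq_imp_distinct_iff)
  then have "flag_sum r x y z d e f + 467 * 7 \<le> 467 * int (max_savings r {x, y, z, d, e, f})"
    using sorted mono by (intro six_point_bound_sorted[OF sym, where k = "r x y"]) (simp_all add: def key_def)
  moreover have "set xs = {x, y, z, d, e, f}" using mset_eq_setD[OF mset] by (simp add: def)
  moreover have "flag_sum_list r xs = flag_sum r x y z d e f"
    using flag_sum_list_perm[of r, OF sym mset len] by (simp add: def)
  ultimately show ?thesis by simp
qed

section \<open>Averaging over six-tuples\<close>

definition tuples :: "'a set \<Rightarrow> 'a list set"
  where "tuples A = {xs. length xs = 6 \<and> distinct xs \<and> set xs \<subseteq> A}"

lemma finite_tuples: "finite A \<Longrightarrow> finite (tuples A)"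
  by (rule finite_subset[OF _ finite_lists_length_eq[of A 6]]) (auto simp: tuples_def)

text \<open>A single product of flags. The form on six points consists of 15 * 3 = 45 such
  products.\<close>

fun pair_form :: "('a \<Rightarrow> 'a \<Rightarrow> bool) \<Rightarrow> 'a list \<Rightarrow> int"
  where
    "pair_form r [x, y, u, v, w, z] =
      flag_prod (r x u = r x y) (r y u = r x y) (r x v = r x y) (r y v = r x y) (r u v = r x y)
        (r x w = r x y) (r y w = r x y) (r x z = r x y) (r y z = r x y) (r w z = r x y)"
  | "pair_form r _ = 0"

text \<open>Rearrangements of the six positions that put the chosen edge first, respectively that keep
  it first and split the other four positions into two pairs.\<close>

definition edge_orders :: "nat list list"
  where "edge_orders =
    [[0,1,2,3,4,5], [0,2,1,3,4,5], [0,3,1,2,4,5], [0,4,1,2,3,5], [0,5,1,2,3,4],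
     [1,2,0,3,4,5], [1,3,0,2,4,5], [1,4,0,2,3,5], [1,5,0,2,3,4], [2,3,0,1,4,5],
     [2,4,0,1,3,5], [2,5,0,1,3,4], [3,4,0,1,2,5], [3,5,0,1,2,4], [4,5,0,1,2,3]]"

definition matchings :: "nat list list"
  where "matchings = [[0,1,2,3,4,5], [0,1,2,4,3,5], [0,1,2,5,3,4]]"

lemma sum_matchings:
  "(\<Sum>js\<leftarrow>matchings. pair_form r (map ((!) [x, y, u, v, w, z]) js)) = edge_term r x y u v w z"
  by (simp add: matchings_def edge_term_def edge_form_def)

lemma flag_sum_list_eq:
  assumes "length xs = 6"
  shows "flag_sum_list r xs =
    (\<Sum>is\<leftarrow>edge_orders. \<Sum>js\<leftarrow>matchings. pair_form r (map ((!) (map ((!) xs) is)) js))"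
proof -
  obtain a b c d e f where xs: "xs = [a, b, c, d, e, f]" using assms length_six by metis
  show ?thesis
    unfolding xs edge_orders_def by (simp add: sum_matchings flag_sum_def add.assoc)
qed

lemma sum_tuples_reindex:
  assumes A: "finite A" and js: "set js = {..<6}" "length js = 6"
  shows "(\<Sum>xs\<in>tuples A. g (map ((!) xs) js)) = (\<Sum>xs\<in>tuples A. g xs)"
proof (rule sum.reindex_bij_betw)
  let ?f = "\<lambda>xs :: 'a list. map ((!) xs) js"
  have dist: "distinct js" using js by (intro card_distinct) simp
  have inj: "inj_on ?f (tuples A)"
  proof (rule inj_onI)
    fix xs ys assume xs: "xs \<in> tuples A" and ys: "ys \<in> tuples A" and eq: "?f xs = ?f ys"
    then have "\<forall>i\<in>set js. xs ! i = ys ! i" by simp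
    then show "xs = ys" using xs ys js by (intro nth_equalityI) (simp_all add: tuples_def)
  qed
  have "?f ` tuples A \<subseteq> tuples A"
  proof
    fix zs assume "zs \<in> ?f ` tuples A"
    then obtain xs where xs: "xs \<in> tuples A" "zs = ?f xs" by blast
    then have "inj_on ((!) xs) (set js)" using js by (simp add: tuples_def inj_on_nth)
    moreover have "set zs \<subseteq> set xs" using xs js by (auto simp: tuples_def)
    ultimately show "zs \<in> tuples A" using xs js dist by (auto simp: tuples_def distinct_map)
  qed
  then show "bij_betw ?f (tuples A) (tuples A)"
    using inj endo_inj_surj[OF finite_tuples[OF A]] unfolding bij_betw_def by blast
qed

lemma sum_sum_list_swap: "(\<Sum>x\<in>S. \<Sum>i\<leftarrow>is. g i x) = (\<Sum>i\<leftarrow>is. \<Sum>x\<in>S. g i x)"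
  by (induction "is") (simp_all add: sum.distrib)

text \<open>The 45 products differ only by a rearrangement of positions, which permutes the tuples,
  so all have the same sum.\<close>

lemma sum_flag_sum_list:
  assumes A: "finite A"
  shows "(\<Sum>xs\<in>tuples A. flag_sum_list r xs) = 45 * (\<Sum>xs\<in>tuples A. pair_form r xs)"
proof -
  have six: "{..<6::nat} = {0, 1, 2, 3, 4, 5}" by auto
  have orders: "set is = {..<6} \<and> length is = 6" if "is \<in> set edge_orders \<union> set matchings" for "is"
    using that unfolding edge_orders_def matchings_def six by auto
  have "(\<Sum>xs\<in>tuples A. flag_sum_list r xs) =
    (\<Sum>xs\<in>tuples A. \<Sum>is\<leftarrow>edge_orders. \<Sum>js\<leftarrow>matchings. pair_form r (map ((!) (map ((!) xs) is)) js))"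
    by (intro sum.cong) (simp_all add: flag_sum_list_eq tuples_def)
  also have "\<dots> = (\<Sum>is\<leftarrow>edge_orders. \<Sum>js\<leftarrow>matchings. \<Sum>xs\<in>tuples A. pair_form r (map ((!) (map ((!) xs) is)) js))"
    by (simp only: sum_sum_list_swap)
  also have "\<dots> = (\<Sum>is\<leftarrow>edge_orders. \<Sum>js\<leftarrow>matchings. \<Sum>xs\<in>tuples A. pair_form r xs)"
  proof (intro arg_cong[where f = sum_list] map_cong refl)
    fix "is" js assume "is \<in> set edge_orders" "js \<in> set matchings"
    then show "(\<Sum>xs\<in>tuples A. pair_form r (map ((!) (map ((!) xs) is)) js)) = (\<Sum>xs\<in>tuples A. pair_form r xs)"
      using sum_tuples_reindex[OF A, of "is" "\<lambda>ys. pair_form r (map ((!) ys) js)"]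
        sum_tuples_reindex[OF A, of js "pair_form r"] orders by simp
  qed
  also have "\<dots> = 45 * (\<Sum>xs\<in>tuples A. pair_form r xs)"
    by (simp add: edge_orders_def matchings_def)
  finally show ?thesis .
qed

section \<open>Near nonnegativity of the averaged form\<close>

lemma abs_flag_le: "\<bar>flag1 a b c d e\<bar> \<le> 15" "\<bar>flag2 a b c d e\<bar> \<le> 15" "\<bar>flag3 a b c d e\<bar> \<le> 15"
  by (auto simp: flag_defs)

text \<open>Three products of weights of absolute value at most 15 give 3 * 15^2 = 675.\<close>

lemma abs_pair_form_le: "\<bar>pair_form r xs\<bar> \<le> 675"
proof -
  have prod: "\<bar>p * q\<bar> \<le> 225" if "\<bar>p\<bar> \<le> 15" "\<bar>q\<bar> \<le> 15" for p q :: int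
    using mult_mono[OF that] by (simp add: abs_mult)
  have "\<bar>flag_prod a b c d e a' b' c' d' e'\<bar> \<le> 675" for a b c d e a' b' c' d' e'
    using prod[OF abs_flag_le(1)[of a b c d e] abs_flag_le(1)[of a' b' c' d' e']]
      prod[OF abs_flag_le(2)[of a b c d e] abs_flag_le(2)[of a' b' c' d' e']]
      prod[OF abs_flag_le(3)[of a b c d e] abs_flag_le(3)[of a' b' c' d' e']]
    unfolding flag_prod_def by linarith
  then show ?thesis by (cases "(r, xs)" rule: pair_form.cases) simp_all
qed

lemma sum_lists_Suc:
  assumes "finite A"
  shows "(\<Sum>xs | set xs \<subseteq> A \<and> length xs = Suc n. g xs) =
    (\<Sum>x\<in>A. \<Sum>xs | set xs \<subseteq> A \<and> length xs = n. g (x # xs))"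
proof -
  have "{xs. set xs \<subseteq> A \<and> length xs = Suc n} =
    (\<lambda>(x, xs). x # xs) ` (A \<times> {xs. set xs \<subseteq> A \<and> length xs = n})"
    by (auto simp: length_Suc_conv image_iff)
  moreover have "inj_on (\<lambda>(x, xs). x # xs) (A \<times> {xs. set xs \<subseteq> A \<and> length xs = n})"
    by (auto intro: inj_onI)
  ultimately show ?thesis
    by (simp add: sum.reindex sum.cartesian_product o_def case_prod_unfold)
qed

text \<open>If repetitions are allowed, the pairs \<open>u v\<close> and \<open>w z\<close> range
  independently, so for fixed \<open>x\<close> and \<open>y\<close> the sum is a sum of three
  squares.\<close>

lemma sum_lists_pair_form_nonneg:
  assumes A: "finite A"
  shows "0 \<le> (\<Sum>xs | set xs \<subseteq> A \<and> length xs = 6. pair_form r xs)"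
proof -
  have zero: "{xs. xs = [] \<and> set xs \<subseteq> A} = {[]}" by auto
  define f where "f q x y u v = q (r x u = r x y) (r y u = r x y) (r x v = r x y) (r y v = r x y) (r u v = r x y)"
    for q :: "bool \<Rightarrow> bool \<Rightarrow> bool \<Rightarrow> bool \<Rightarrow> bool \<Rightarrow> int" and x y u v
  have form: "pair_form r [x, y, u, v, w, z] = f flag1 x y u v * f flag1 x y w z +
      f flag2 x y u v * f flag2 x y w z + f flag3 x y u v * f flag3 x y w z" for x y u v w z
    by (simp add: flag_prod_def f_def)
  have square: "(\<Sum>u\<in>A. \<Sum>v\<in>A. \<Sum>w\<in>A. \<Sum>z\<in>A. f q x y u v * f q x y w z) =
      (\<Sum>u\<in>A. \<Sum>v\<in>A. f q x y u v)\<^sup>2" for q x y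
  proof -
    have "(\<Sum>u\<in>A. \<Sum>v\<in>A. f q x y u v)\<^sup>2 =
        (\<Sum>u\<in>A. \<Sum>v\<in>A. f q x y u v * (\<Sum>w\<in>A. \<Sum>z\<in>A. f q x y w z))"
      unfolding power2_eq_square by (simp only: sum_distrib_right)
    then show ?thesis by (simp add: sum_distrib_left)
  qed
  have "(\<Sum>xs | set xs \<subseteq> A \<and> length xs = 6. pair_form r xs) =
    (\<Sum>x\<in>A. \<Sum>y\<in>A. \<Sum>u\<in>A. \<Sum>v\<in>A. \<Sum>w\<in>A. \<Sum>z\<in>A. pair_form r [x, y, u, v, w, z])"
    by (simp add: eval_nat_numeral sum_lists_Suc[OF A] zero)
  also have "\<dots> = (\<Sum>x\<in>A. \<Sum>y\<in>A. (\<Sum>u\<in>A. \<Sum>v\<in>A. f flag1 x y u v)\<^sup>2 +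
      (\<Sum>u\<in>A. \<Sum>v\<in>A. f flag2 x y u v)\<^sup>2 + (\<Sum>u\<in>A. \<Sum>v\<in>A. f flag3 x y u v)\<^sup>2)"
    by (simp add: form sum.distrib square del: pair_form.simps)
  also have "\<dots> \<ge> 0" by (intro sum_nonneg) simp
  finally show ?thesis .
qed

text \<open>This bounds n (n - 1) ... (n - 5) from below, where 15 = 1 + 2 + 3 + 4 + 5. Setting n =
  m + 6 avoids truncated subtraction.\<close>

lemma card_tuples_ge:
  assumes A: "finite A" and n: "card A = n" "6 \<le> n"
  shows "int n ^ 6 - 15 * int n ^ 5 \<le> int (card (tuples A))"
proof -
  have "card (tuples A) = \<Prod>{n - 6 + 1..n}"
    unfolding tuples_def using card_lists_distinct_length_eq[OF A, of 6] n by simp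
  moreover obtain m where m: "n = m + 6" using n(2) by (metis add.commute le_iff_add)
  moreover have "{m + 1..m + 6} = {m + 1, m + 2, m + 3, m + 4, m + 5, m + 6}" by auto
  ultimately have "card (tuples A) = (m + 1) * (m + 2) * (m + 3) * (m + 4) * (m + 5) * (m + 6)"
    by (simp add: algebra_simps)
  then have "int (card (tuples A)) =
      (int m + 1) * (int m + 2) * (int m + 3) * (int m + 4) * (int m + 5) * (int m + 6)"
    by (simp only: of_nat_mult of_nat_add of_nat_1 of_nat_numeral)
  moreover have "int n ^ 6 - 15 * int n ^ 5 \<le>
    (int m + 1) * (int m + 2) * (int m + 3) * (int m + 4) * (int m + 5) * (int m + 6)"
    unfolding m by (simp add: algebra_simps eval_nat_numeral)
  ultimately show ?thesis by simp
qed

text \<open>At most 15 n^5 lists have a repetition. Dropping them from the nonnegative full sum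
  costs at most 675 each, and 15 * 675 = 10125.\<close>

lemma sum_pair_form_ge:
  assumes A: "finite A" and n: "card A = n" "6 \<le> n"
  shows "- (10125 * int n ^ 5) \<le> (\<Sum>xs\<in>tuples A. pair_form r xs)"
proof -
  let ?L = "{xs. set xs \<subseteq> A \<and> length xs = 6}"
  have fin: "finite ?L" using finite_lists_length_eq[OF A] .
  have sub: "tuples A \<subseteq> ?L" by (auto simp: tuples_def)
  have "card (?L - tuples A) = card ?L - card (tuples A)"
    using sub fin by (meson card_Diff_subset finite_subset)
  moreover have "card ?L = n ^ 6" using card_lists_length_eq[OF A] n by simp
  moreover have "card (tuples A) \<le> card ?L" by (rule card_mono[OF fin sub])
  ultimately have card: "int (card (?L - tuples A)) \<le> 15 * int n ^ 5"
    using card_tuples_ge[OF assms] by (simp add: of_nat_diff)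
  have "(\<Sum>xs\<in>?L - tuples A. pair_form r xs) \<le> (\<Sum>xs\<in>?L - tuples A. 675)"
    by (rule sum_mono) (use abs_pair_form_le abs_le_iff in blast)
  also have "\<dots> \<le> 675 * (15 * int n ^ 5)" using card by simp
  finally have "(\<Sum>xs\<in>?L - tuples A. pair_form r xs) \<le> 10125 * int n ^ 5" by simp
  moreover have "(\<Sum>xs\<in>?L. pair_form r xs) =
      (\<Sum>xs\<in>?L - tuples A. pair_form r xs) + (\<Sum>xs\<in>tuples A. pair_form r xs)"
    by (rule sum.subset_diff[OF sub fin])
  ultimately show ?thesis using sum_lists_pair_form_nonneg[OF A, of r] by linarith
qed

text \<open>The error is 45 * 10125 / 467 < 976 times n^5.\<close>

lemma sum_max_savings_tuples:
  assumes sym: "\<And>x y. r x y = r y x" and A: "finite A" and n: "card A = n" "6 \<le> n"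
  shows "7 * int (card (tuples A)) - 976 * int n ^ 5 \<le> (\<Sum>xs\<in>tuples A. int (max_savings r (set xs)))"
proof -
  have "(\<Sum>xs\<in>tuples A. flag_sum_list r xs + 467 * 7) \<le> (\<Sum>xs\<in>tuples A. 467 * int (max_savings r (set xs)))"
    using six_point_bound[of r, OF sym] by (intro sum_mono) (auto simp: tuples_def)
  then have "45 * (\<Sum>xs\<in>tuples A. pair_form r xs) + 467 * 7 * int (card (tuples A)) \<le>
    467 * (\<Sum>xs\<in>tuples A. int (max_savings r (set xs)))"
    using sum_flag_sum_list[OF A, of r] by (simp add: sum.distrib sum_distrib_left)
  moreover have "0 \<le> int n ^ 5" by simp
  ultimately show ?thesis using sum_pair_form_ge[OF A n, of r] by linarith
qed

section \<open>Averaging over placements of a family of six-tuples\<close>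

text \<open>The positionwise map from \<open>xs\<close> to \<open>ys\<close> is extended by a
  bijection between the complements, which have equal size.\<close>

lemma distinct_lists_permutation:
  assumes A: "finite A" and xs: "distinct xs" "set xs \<subseteq> A" and ys: "distinct ys" "set ys \<subseteq> A"
    and len: "length xs = length ys"
  obtains p where "p permutes A" "map p xs = ys"
proof -
  have "card (A - set xs) = card (A - set ys)"
    using assms by (simp add: card_Diff_subset distinct_card)
  then obtain g where g: "bij_betw g (A - set xs) (A - set ys)"
    using finite_same_card_bij A by (metis finite_Diff)
  define h where "h x = the (map_of (zip xs ys) x)" for x
  have h: "map h xs = ys"
    using len xs(1) by (intro nth_equalityI) (simp_all add: h_def map_of_zip_nth)
  then have "set ys = h ` set xs" by (metis set_map)
  moreover have "inj_on h (set xs)" using h ys(1) by (metis distinct_map)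
  ultimately have "bij_betw h (set xs) (set ys)" by (simp add: bij_betw_def)
  define p where "p x = (if x \<in> set xs then h x else if x \<in> A then g x else x)" for x
  have "bij_betw p (set xs) (set ys)"
    using \<open>bij_betw h (set xs) (set ys)\<close> by (rule bij_betw_cong[THEN iffD1, rotated]) (simp add: p_def)
  moreover have "bij_betw p (A - set xs) (A - set ys)"
    using g by (rule bij_betw_cong[THEN iffD1, rotated]) (simp add: p_def)
  ultimately have "bij_betw p (set xs \<union> (A - set xs)) (set ys \<union> (A - set ys))"
    by (rule bij_betw_combine) blast
  moreover have "set xs \<union> (A - set xs) = A" "set ys \<union> (A - set ys) = A" using xs ys by auto
  ultimately have "bij_betw p A A" by simp
  then have "p permutes A"
    by (rule bij_imp_permutes) (use xs(2) in \<open>auto simp: p_def\<close>)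
  moreover have "map p xs = ys" unfolding h[symmetric] by (simp add: p_def)
  ultimately show thesis by (rule that)
qed

text \<open>For a fixed tuple \<open>xs\<close>, the sum of \<open>g (map p xs)\<close> over all permutations \<open>p\<close> does not
  depend on \<open>xs\<close>, so it is \<open>card A!\<close> times the mean of \<open>g\<close>.\<close>

lemma exists_good_permutation:
  fixes g :: "'a list \<Rightarrow> int"
  assumes A: "finite A" and blk: "\<And>j. j \<in> J \<Longrightarrow> blk j \<in> tuples A"
  obtains p where "p permutes A"
    "int (card J) * (\<Sum>xs\<in>tuples A. g xs) \<le> int (card (tuples A)) * (\<Sum>j\<in>J. g (map p (blk j)))"
proof -
  note result = that
  let ?S = "{p. p permutes A}" and ?D = "tuples A"
  define H where "H xs = (\<Sum>p\<in>?S. g (map p xs))" for xs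
  have finS: "finite ?S" using finite_permutations[OF A] .
  have H_const: "H xs = H ys" if D: "xs \<in> ?D" "ys \<in> ?D" for xs ys
  proof -
    obtain q where q: "q permutes A" "map q xs = ys"
      by (rule distinct_lists_permutation[OF A, of xs ys]) (use D in \<open>auto simp: tuples_def\<close>)
    have "H xs = (\<Sum>p\<in>?S. g (map (p \<circ> q) xs))"
      unfolding H_def using sum_permutations_compose_right[OF q(1), of "\<lambda>p. g (map p xs)"] by simp
    also have "\<dots> = H ys"
      unfolding H_def q(2)[symmetric] by simp
    finally show ?thesis .
  qed
  have map_D: "(\<Sum>xs\<in>?D. g (map p xs)) = (\<Sum>xs\<in>?D. g xs)" if "p permutes A" for p
  proof (rule sum.reindex_bij_betw)
    have inj: "inj_on (map p) ?D"
      using permutes_inj[OF that] by (simp add: inj_on_def inj_map_eq_map)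
    have "map p ` ?D \<subseteq> ?D"
    proof
      fix ys assume "ys \<in> map p ` ?D"
      then obtain xs where xs: "xs \<in> ?D" "ys = map p xs" by blast
      then have "set ys \<subseteq> A" using permutes_in_image[OF that] by (fastforce simp: tuples_def)
      then show "ys \<in> ?D" using xs permutes_inj_on[OF that] by (simp add: tuples_def distinct_map)
    qed
    then show "bij_betw (map p) ?D ?D"
      using inj endo_inj_surj[OF finite_tuples[OF A]] unfolding bij_betw_def by blast
  qed
  have mean: "int (card ?D) * H ys = int (card ?S) * (\<Sum>xs\<in>?D. g xs)" if "ys \<in> ?D" for ys
  proof -
    have "int (card ?D) * H ys = (\<Sum>xs\<in>?D. H xs)"
      using H_const[OF _ that] by (simp add: sum.cong)
    also have "\<dots> = (\<Sum>p\<in>?S. \<Sum>xs\<in>?D. g (map p xs))"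
      unfolding H_def by (rule sum.swap)
    also have "\<dots> = int (card ?S) * (\<Sum>xs\<in>?D. g xs)" using map_D by simp
    finally show ?thesis .
  qed
  show thesis
  \<comment> \<open>If every permutation fell below the average, summing over all permutations would
    contradict \<open>mean\<close>.\<close>
  proof (rule ccontr)
    assume "\<not> thesis"
    then have less: "int (card ?D) * (\<Sum>j\<in>J. g (map p (blk j))) < int (card J) * (\<Sum>xs\<in>?D. g xs)"
      if "p \<in> ?S" for p
      using that \<open>\<not> thesis\<close> result[of p] by (metis linorder_not_le mem_Collect_eq)
    have ne: "?S \<noteq> {}" using permutes_id by blast
    have "(\<Sum>p\<in>?S. int (card ?D) * (\<Sum>j\<in>J. g (map p (blk j)))) < (\<Sum>p\<in>?S. int (card J) * (\<Sum>xs\<in>?D. g xs))"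
      by (rule sum_strict_mono[OF finS ne]) (rule less)
    also have "(\<Sum>p\<in>?S. int (card ?D) * (\<Sum>j\<in>J. g (map p (blk j)))) = (\<Sum>j\<in>J. int (card ?D) * H (blk j))"
      unfolding H_def sum_distrib_left by (rule sum.swap)
    also have "\<dots> = (\<Sum>j\<in>J. int (card ?S) * (\<Sum>xs\<in>?D. g xs))"
      using mean blk by (intro sum.cong) auto
    finally show False by (simp add: algebra_simps)
  qed
qed

section \<open>The transversal design\<close>

text \<open>The groups are the six fibres of the first coordinate, each of size \<open>p\<close>. Two points in different groups lie
  in exactly one line, because \<open>p\<close> is coprime to the differences \<open>1, \<dots>, 5\<close> of the groups.\<close>

definition line :: "nat \<Rightarrow> nat \<times> nat \<Rightarrow> (nat \<times> nat) list"
  where "line p ab = map (\<lambda>i. (i, (fst ab * i + snd ab) mod p)) [0..<6]"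

lemma dvd_int_diff_imp_eq:
  assumes "int p dvd int a - int b" "a < p" "b < p" shows "a = b"
proof -
  have "\<bar>int a - int b\<bar> < int p" using assms(2,3) by auto
  then have "int a - int b = 0" using assms(1) dvd_imp_le_int[of "int a - int b" "int p"] by fastforce
  then show ?thesis by simp
qed

text \<open>The difference of two groups is one of 1, ..., 5, hence coprime to \<open>p\<close>, and
  can be cancelled.\<close>

lemma dvd_small_multiple:
  fixes a a' i j p :: nat
  assumes p: "coprime p 30" and ij: "i < j" "j < 6" and a: "a < p" "a' < p"
    and dvd: "int p dvd (int a - int a') * (int j - int i)"
  shows "a = a'"
proof -
  have "j - i \<in> {1, 2, 3, 4, 5}" using ij by auto
  moreover have dvd30: "coprime p d" if "d dvd 30" for d
    using coprime_divisors[of p p d 30] that p by simp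
  moreover have "coprime p 2" "coprime p 3" "coprime p 5" by (rule dvd30, simp)+
  moreover have "coprime p 4" using \<open>coprime p 2\<close> coprime_power_right_iff[of p 2 2] by simp
  ultimately have "coprime p (j - i)" by auto
  then have "coprime (int p) (int j - int i)"
    using ij coprime_int_iff[of p "j - i"] by (simp add: of_nat_diff)
  then have "int p dvd int a - int a'"
    using dvd by (simp add: coprime_dvd_mult_left_iff)
  then show ?thesis using a by (rule dvd_int_diff_imp_eq)
qed

text \<open>Two common points lie in different groups \<open>i\<close> and \<open>j\<close>.
  Subtracting their congruences gives equal slopes, and then equal intercepts.\<close>

lemma lines_meet:
  assumes p: "coprime p 30"
    and ab: "ab \<in> {..<p} \<times> {..<p}" "cd \<in> {..<p} \<times> {..<p}" "ab \<noteq> cd"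
  shows "card (set (line p ab) \<inter> set (line p cd)) \<le> 1"
proof (rule ccontr)
  obtain a b c d where abcd: "ab = (a, b)" "cd = (c, d)" by (cases ab; cases cd) blast
  then have bounds: "a < p" "b < p" "c < p" "d < p" using ab by auto
  let ?M = "set (line p ab) \<inter> set (line p cd)"
  assume "\<not> card ?M \<le> 1"
  then have "\<not> (\<forall>x\<in>?M. \<forall>y\<in>?M. x = y)" using card_le_Suc0_iff_eq[of ?M] by simp
  then obtain x y where xy: "x \<in> ?M" "y \<in> ?M" "x \<noteq> y" by blast
  have eq: "(a * i + b) mod p = (c * i + d) mod p" "i < 6" "x' = (i, (a * i + b) mod p)"
    if "x' \<in> ?M" "i = fst x'" for x' i
    using that by (auto simp: line_def abcd)
  have "fst x \<noteq> fst y" using eq(3)[OF xy(1) refl] eq(3)[OF xy(2) refl] xy(3) by metis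
  then obtain i j where ij: "i < j" "{i, j} = {fst x, fst y}"
    by (metis doubleton_eq_iff nat_neq_iff)
  have cong: "int p dvd (int a * int k + int b) - (int c * int k + int d)" "k < 6" if "k \<in> {i, j}" for k
  proof -
    have "k \<in> {fst x, fst y}" using that ij(2) by simp
    then have "\<exists>v. v \<in> ?M \<and> k = fst v" using xy(1) xy(2) by (metis insertE singletonD)
    then obtain v where v: "v \<in> ?M" "k = fst v" by blast
    have "(a * k + b) mod p = (c * k + d) mod p" "k < 6"
      using eq(1,2)[OF v] .
    then have "int (a * k + b) mod int p = int (c * k + d) mod int p"
      by (metis of_nat_mod)
    then show "int p dvd (int a * int k + int b) - (int c * int k + int d)"
      by (simp add: mod_eq_dvd_iff)
    show "k < 6" by fact
  qed
  have "int p dvd ((int a * int j + int b) - (int c * int j + int d)) - ((int a * int i + int b) - (int c * int i + int d))"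
    using dvd_diff[OF cong(1)[of j] cong(1)[of i]] by simp
  then have "int p dvd (int a - int c) * (int j - int i)" by (simp add: algebra_simps)
  then have ac: "a = c"
    using dvd_small_multiple[OF p ij(1) _ bounds(1,3)] cong(2)[of j] by simp
  then have "int p dvd int b - int d" using cong(1)[of i] by simp
  then have "b = d" using bounds(2,4) by (rule dvd_int_diff_imp_eq)
  then show False using ac ab(3) abcd by simp
qed

text \<open>A good placement makes the p^2 lines save 7 each on average, up to an error; the six
  groups of size \<open>p\<close> contribute \<open>m\<close> each.\<close>

lemma design_savings:
  fixes r :: "'a \<Rightarrow> 'a \<Rightarrow> bool"
  assumes sym: "\<And>x y. r x y = r y x" and V: "finite V" and card: "card V = 6 * p"
    and p: "coprime p 30" "5 \<le> p"
    and groups: "\<And>U. U \<subseteq> V \<Longrightarrow> card U = p \<Longrightarrow> m \<le> max_savings r U"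
  shows "7 * int p ^ 2 - 326 * int p + 6 * int m \<le> int (max_savings r V)"
proof -
  let ?I = "{..<6::nat} \<times> {..<p}" and ?J = "{..<p} \<times> {..<p}" and ?n = "6 * p"
  obtain e where e: "bij_betw e ?I V"
    using finite_same_card_bij[of ?I V] V card by auto
  have inj: "inj_on e ?I" and img: "e ` ?I = V" using e by (auto simp: bij_betw_def)
  have line_sub: "set (line p ab) \<subseteq> ?I" for ab
    using p(2) by (auto simp: line_def)
  have line_dist: "distinct (line p ab)" "length (line p ab) = 6" for ab
    by (auto simp: line_def distinct_map inj_on_def)
  have blk: "map e (line p ab) \<in> tuples V" for ab
  proof -
    have "set (map e (line p ab)) \<subseteq> V"
      using image_mono[OF line_sub, of e ab] img by simp
    then show ?thesis
      using line_dist inj_on_subset[OF inj line_sub] by (simp add: tuples_def distinct_map)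
  qed
  obtain q where q: "q permutes V" and good:
    "int (card ?J) * (\<Sum>xs\<in>tuples V. int (max_savings r (set xs))) \<le>
      int (card (tuples V)) * (\<Sum>ab\<in>?J. int (max_savings r (set (map q (map e (line p ab))))))"
    by (rule exists_good_permutation[OF V, of ?J "\<lambda>ab. map e (line p ab)" "\<lambda>xs. int (max_savings r (set xs))"])
      (use blk in auto)
  define h where "h = q \<circ> e"
  have h: "inj_on h ?I" "h ` ?I = V"
    unfolding h_def using inj img permutes_inj_on[OF q] permutes_image[OF q]
    by (auto intro: comp_inj_on simp: image_comp[symmetric])
  define X where "X = (\<Sum>ab\<in>?J. int (max_savings r (h ` set (line p ab))))"
  define T where "T = int (card (tuples V))"
  have good': "int p ^ 2 * (\<Sum>xs\<in>tuples V. int (max_savings r (set xs))) \<le> T * X"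
    using good by (simp add: X_def T_def h_def image_comp power2_eq_square)
  have n: "card V = ?n" "6 \<le> ?n" using card p(2) by auto
  have "int p ^ 2 * (7 * T - 976 * int ?n ^ 5) \<le> T * X"
    using good' sum_max_savings_tuples[of r, OF sym V n]
    unfolding T_def by (meson mult_left_mono order_trans zero_le_power2)
  \<comment> \<open>From N >= 30 follows N^6 <= 2 T, that is 3 p N^5 <= T, and 3 * 326 = 978 >=
    976.\<close>
  moreover have "int p ^ 2 * (976 * int ?n ^ 5) \<le> T * (326 * int p)"
  proof -
    define N where "N = int ?n"
    have N: "N = 6 * int p" "30 \<le> N" using p(2) by (simp_all add: N_def)
    have "N ^ 6 = N ^ 5 * N" by (simp add: eval_nat_numeral)
    moreover have "N ^ 6 - 15 * N ^ 5 \<le> T"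
      using card_tuples_ge[OF V n] by (simp add: T_def N_def)
    moreover have "N ^ 5 * 30 \<le> N ^ 5 * N" using N(2) by (intro mult_left_mono) auto
    ultimately have "N ^ 5 * N \<le> 2 * T" by linarith
    then have "3 * (int p * N ^ 5) \<le> T" unfolding N(1)[symmetric] by (simp add: N(1))
    then have "326 * int p * (3 * (int p * N ^ 5)) \<le> 326 * int p * T"
      by (intro mult_left_mono) auto
    moreover have "0 \<le> int p * (int p * N ^ 5)" using N(2) by simp
    moreover have "326 * int p * (3 * (int p * N ^ 5)) = 978 * (int p * (int p * N ^ 5))" by simp
    moreover have "int p ^ 2 * (976 * N ^ 5) = 976 * (int p * (int p * N ^ 5))"
      by (simp add: power2_eq_square)
    moreover have "T * (326 * int p) = 326 * int p * T" by simp
    ultimately show ?thesis unfolding N_def by linarith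
  qed
  moreover have T: "0 < T"
  proof -
    have "map e (line p (0, 0)) \<in> tuples V" by (rule blk)
    then show ?thesis unfolding T_def using finite_tuples[OF V] by (auto simp: card_gt_0_iff)
  qed
  ultimately have "T * (7 * int p ^ 2 - 326 * int p) \<le> T * X"
    by (simp add: algebra_simps)
  then have lines: "7 * int p ^ 2 - 326 * int p \<le> X"
    using T by (simp add: mult_le_cancel_left_pos)
  \<comment> \<open>Lines and groups together form blocks that pairwise share at most one point,
    indexed by a disjoint sum.\<close>
  define B where "B = case_sum (\<lambda>ab. set (line p ab)) (\<lambda>i. {i} \<times> {..<p})"
  let ?K = "Inl ` ?J \<union> Inr ` {..<6::nat}"
  have B_sub: "B k \<subseteq> ?I" if "k \<in> ?K" for k
    using that line_sub by (cases k) (simp_all add: B_def image_iff, auto)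
  have B_meet: "card (B k \<inter> B l) \<le> 1" if "k \<in> ?K" "l \<in> ?K" "k \<noteq> l" for k l
  proof -
    have mixed: "card (set (line p ab) \<inter> {i} \<times> {..<p}) \<le> 1" for ab i
    proof -
      have "set (line p ab) \<inter> {i} \<times> {..<p} \<subseteq> {(i, (fst ab * i + snd ab) mod p)}"
        by (auto simp: line_def)
      then show ?thesis using card_mono[OF finite.insertI[OF finite.emptyI]] by fastforce
    qed
    show ?thesis
    proof (cases k)
      case (Inl ab)
      show ?thesis
      proof (cases l)
        case (Inl cd)
        then show ?thesis using \<open>k = Inl ab\<close> that lines_meet[OF p(1), of ab cd] by (auto simp: B_def)
      next
        case (Inr i)
        then show ?thesis using \<open>k = Inl ab\<close> mixed by (simp add: B_def)
      qed
    next
      case (Inr i)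
      show ?thesis
      proof (cases l)
        case (Inl cd)
        then show ?thesis using \<open>k = Inr i\<close> mixed by (simp add: B_def Int_commute)
      next
        case (Inr j)
        then have "{i} \<times> {..<p} \<inter> {j} \<times> {..<p} = {}" using \<open>k = Inr i\<close> that by auto
        then show ?thesis using \<open>k = Inr i\<close> Inr by (simp add: B_def)
      qed
    qed
  qed
  have "(\<Sum>k\<in>?K. max_savings r (h ` B k)) \<le> max_savings r V"
  proof (rule max_savings_superadditive[OF V])
    show "finite ?K" by simp
    show "h ` B k \<subseteq> V" if "k \<in> ?K" for k using B_sub[OF that] h(2) by blast
    show "card (h ` B k \<inter> h ` B l) \<le> 1" if kl: "k \<in> ?K" "l \<in> ?K" "k \<noteq> l" for k l
    proof -
      have "h ` B k \<inter> h ` B l = h ` (B k \<inter> B l)"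
        using inj_on_image_Int[OF h(1) B_sub[OF kl(1)] B_sub[OF kl(2)]] by simp
      moreover have "finite (B k \<inter> B l)"
        using B_sub[OF kl(1)] by (meson finite_Int finite_SigmaI finite_lessThan finite_subset)
      ultimately show ?thesis using B_meet[OF kl] card_image_le le_trans by metis
    qed
  qed
  moreover have "(\<Sum>k\<in>?K. max_savings r (h ` B k)) =
      (\<Sum>ab\<in>?J. max_savings r (h ` set (line p ab))) + (\<Sum>i<6. max_savings r (h ` ({i} \<times> {..<p})))"
    by (subst sum.union_disjoint) (auto simp: sum.reindex B_def)
  moreover have "(\<Sum>i<6::nat. m) \<le> (\<Sum>i<6. max_savings r (h ` ({i} \<times> {..<p})))"
  proof (intro sum_mono groups)
    fix i :: nat assume "i \<in> {..<6}"
    then have sub: "{i} \<times> {..<p} \<subseteq> ?I" by auto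
    then show "h ` ({i} \<times> {..<p}) \<subseteq> V" using h(2) by blast
    show "card (h ` ({i} \<times> {..<p})) = p"
      using card_image[OF inj_on_subset[OF h(1) sub]] by simp
  qed
  ultimately have "(\<Sum>ab\<in>?J. max_savings r (h ` set (line p ab))) + 6 * m \<le> max_savings r V"
    by simp
  moreover have "X = int (\<Sum>ab\<in>?J. max_savings r (h ` set (line p ab)))"
    by (simp add: X_def)
  ultimately show ?thesis using lines by linarith
qed

section \<open>Induction on the number of vertices\<close>

lemma max_savings_mono:
  assumes "finite V" "U \<subseteq> V" shows "max_savings r U \<le> max_savings r V"
  using max_savings_superadditive[OF assms(1), of "{()}" "\<lambda>_. U" r] assms(2) by simp

text \<open>With coefficient c, the recursion needs 7 + 6 c >= 36 c, that is c <= 7/30. As 365/1568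
  is strictly smaller, the slack absorbs the linear losses for large n.\<close>

theorem max_savings_quadratic:
  fixes r :: "'a \<Rightarrow> 'a \<Rightarrow> bool"
  assumes sym: "\<And>x y. r x y = r y x" and "finite V"
  shows "365 / 1568 * real (card V) ^ 2 - 100000 * real (card V) \<le> real (max_savings r V)"
  using assms(2)
proof (induction "card V" arbitrary: V rule: less_induct)
  case less
  define n where "n = card V"
  show ?case
  proof (cases "n < 400000")
    case True
    \<comment> \<open>The claimed bound is not positive here, since 400000 * 365/1568 <
      100000.\<close>
    then have "365 / 1568 * real n * real n \<le> 100000 * real n"
      by (intro mult_right_mono) auto
    then have "365 / 1568 * real n ^ 2 - 100000 * real n \<le> 0"
      by (simp add: power2_eq_square)
    then show ?thesis unfolding n_def by (smt (verit) of_nat_0_le_iff)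
  next
    case False
    \<comment> \<open>The largest \<open>p\<close> congruent to 1 modulo 30 with 6 p <= n; fewer
      than 180 vertices are left over.\<close>
    define p where "p = 30 * ((n - 6) div 180) + 1"
    define s where "s = (n - 6) mod 180"
    have n: "n = 6 * p + s"
      using False unfolding p_def s_def by (simp add: algebra_simps)
    have s: "s < 180" by (simp add: s_def)
    then have p: "50000 \<le> p" "p < n" using False n by auto
    have coprime: "coprime p 30"
    proof (rule coprimeI)
      fix d assume "d dvd p" "d dvd 30"
      then have "d dvd 30 * ((n - 6) div 180)" by (simp add: dvd_mult2)
      from dvd_add_right_iff[OF this, of 1] show "is_unit d" using \<open>d dvd p\<close> by (simp add: p_def)
    qed
    have "6 * p \<le> card V" using n n_def by linarith
    then obtain U where U: "U \<subseteq> V" "card U = 6 * p"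
      by (rule obtain_subset_with_card_n)
    define t where "t = 365 / 1568 * real p ^ 2 - 100000 * real p"
    \<comment> \<open>Rounding up loses nothing, as savings are integers; a negative
      \<open>t\<close> gives 0.\<close>
    define m where "m = nat \<lceil>t\<rceil>"
    have groups: "m \<le> max_savings r W" if "W \<subseteq> U" "card W = p" for W
    proof -
      have "finite W" using finite_subset[OF subset_trans[OF that(1) U(1)] less.prems] .
      then have "t \<le> real (max_savings r W)"
        using less.hyps[of W] p(2) that(2) by (simp add: n_def t_def)
      then show ?thesis unfolding m_def by linarith
    qed
    have "7 * int p ^ 2 - 326 * int p + 6 * int m \<le> int (max_savings r U)"
      using U finite_subset[OF U(1) less.prems] coprime p(1) groups
      by (intro design_savings[of r, OF sym]) auto
    then have "real_of_int (7 * int p ^ 2 - 326 * int p + 6 * int m) \<le> real_of_int (int (max_savings r U))"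
      by (simp only: of_int_le_iff)
    then have "7 * real p ^ 2 - 326 * real p + 6 * real m \<le> real (max_savings r U)" by simp
    moreover have "t \<le> real m" unfolding m_def by linarith
    moreover have "max_savings r U \<le> max_savings r V" by (rule max_savings_mono[OF less.prems U(1)])
    ultimately have "7 * real p ^ 2 - 326 * real p + 6 * t \<le> real (max_savings r V)" by linarith
    \<comment> \<open>The slack (7 - 30 * 365/1568) p^2 is at least 829 p for p >= 50000. It covers
      326 p and the cross term of \<open>p\<close> and \<open>s\<close>, which is below 503 p; the
      term in s^2 is covered by 100000 s.\<close>
    moreover have "365 / 1568 * real n ^ 2 - 100000 * real n \<le> 7 * real p ^ 2 - 326 * real p + 6 * t"
    proof -
      have "real p * 50000 \<le> real p * real p" using p(1) by (intro mult_left_mono) auto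
      moreover have "real p * real s \<le> real p * 180" "real s * real s \<le> 180 * real s"
        using s by (auto intro!: mult_left_mono mult_right_mono)
      moreover have "real n = 6 * real p + real s" using n by simp
      ultimately show ?thesis
        unfolding t_def by (simp add: power2_eq_square algebra_simps)
    qed
    ultimately show ?thesis unfolding n_def by linarith
  qed
qed

theorem theorem14:
  shows "\<exists>(f :: nat \<Rightarrow> real) (g :: nat \<Rightarrow> real).
    f \<in> o(\<lambda>n. real n ^ 2) \<and> g \<in> o(\<lambda>n. real n ^ 4) \<and>
    (\<forall>n. \<forall>(V :: 'a set) E. fin_simple_graph V E \<and> card V = n \<longrightarrow>
      real (scp V E) + real (scp V (complement_edges V E))
        \<le> 1203 / 1568 * real n ^ 2 + f n \<and>
      real (scp V E) * real (scp V (complement_edges V E))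
        \<le> 1447209 / 9834496 * real n ^ 4 + g n)"
proof (intro exI conjI allI impI; (elim conjE)?)
  show "(\<lambda>n. 100000 * real n) \<in> o(\<lambda>n. real n ^ 2)" by real_asymp
  \<comment> \<open>The lower-order terms of a quarter of the square of the bound for the
    sum.\<close>
  show "(\<lambda>n. 1203 / 1568 * 50000 * real n ^ 3 + 50000\<^sup>2 * real n ^ 2) \<in> o(\<lambda>n. real n ^ 4)"
    by real_asymp
next
  fix n and V :: "'a set" and E
  assume G: "fin_simple_graph V E" and n: "card V = n"
  let ?a = "real (scp V E)" and ?b = "real (scp V (complement_edges V E))"
  let ?r = "\<lambda>x y. {x, y} \<in> E"
  have "real (scp V E + scp V (complement_edges V E) + max_savings ?r V) \<le> real (card V * (card V - 1))"
    using scp_complement_sum[OF G] by (simp only: of_nat_le_iff)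
  also have "\<dots> \<le> real n ^ 2"
    unfolding n of_nat_mult power2_eq_square by (intro mult_left_mono) auto
  finally have "?a + ?b + real (max_savings ?r V) \<le> real n ^ 2" by simp
  moreover have "365 / 1568 * real n ^ 2 - 100000 * real n \<le> real (max_savings ?r V)"
    using max_savings_quadratic[of ?r V] G n by (auto simp: insert_commute fin_simple_graph_def)
  ultimately show sum: "?a + ?b \<le> 1203 / 1568 * real n ^ 2 + 100000 * real n" by simp
  \<comment> \<open>The inequality of the means; 1447209 = 1203^2 and 9834496 = 4 * 1568^2.\<close>
  have "4 * (?a * ?b) \<le> (?a + ?b)\<^sup>2"
    using zero_le_power2[of "?a - ?b"] by (simp add: power2_eq_square algebra_simps)
  also have "\<dots> \<le> (1203 / 1568 * real n ^ 2 + 100000 * real n)\<^sup>2"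
    using sum by (intro power_mono) auto
  finally show "?a * ?b \<le> 1447209 / 9834496 * real n ^ 4 +
      (1203 / 1568 * 50000 * real n ^ 3 + 50000\<^sup>2 * real n ^ 2)"
    by (simp add: power2_eq_square eval_nat_numeral algebra_simps)
qed

end
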